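(* Let $(f_i)_{i=1}^\infty$ be a sequence of maps, each as in the setting below and satisfying condition (i), let $(m_i)_{i=1}^\infty$ be a sequence in $\mathbb N$, and let $(\bar p_i)_{i=1}^\infty$ be such that $\bar p_i\in[0,1]^{g_{f_i}^{m_i}}$ for each $i$. Then \[ \dim_H\Big(\bigcap_{i=1}^\infty\{x: \bar p_i\in A^{f_i,m_i}(x)\}\Big)=\inf_i \dim_H\big(\{x:\bar p_i\in A^{f_i,m_i}(x)\}\big). \]
   Context: Setting: $f\colon[0,1)\to[0,1)$ and $g_f\ge 2$ is an integer such that $[0,1)$ is partitioned into $g_f$ half-open intervals $[a,b)$, enumerated as $[0],\dots,[g_f-1]$, such that on each of them $f$ is monotone and maps onto $[0,1)$, and $|f(x)-f(y)|\ge |x-y|$ for all $x,y$ in the same interval. For a word $x_1\dots x_n$ over $\{0,\dots,g_f-1\}$ the generation-$n$ cylinder is $C_{x_1\dots x_n}=\{x\in[0,1): f^{i-1}(x)\in[x_i],\ i=1,\dots,n\}$; $[0,1)$ is the generation-$0$ cylinder. It is assumed that $|C_{x_1\dots x_n}|\to 0$ as $n\to\infty$ for every $(x_i)\in\{0,\dots,g_f-1\}^{\mathbb N}$, so each $x\in[0,1)$ has a unique coding sequence $(x_i)_{i\ge1}$ (its $f$-expansion). Condition (i) (bounded distortion): there is $K_f>0$ such that for every cylinder $C_{x_1\dots x_n}$ (including $[0,1)$), $|(f^n)'(y)|/|(f^n)'(z)|<K_f$ for all $y,z\in C_{x_1\dots x_n}$; this implies $|C_{x_1\dots x_{n+1}}|/|C_{x_1\dots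 x_n}|>1/(g_fK_f)$ for all sequences and all $n$. Frequencies: for $m\in\mathbb N$ enumerate the $g_f^m$ words of length $m$ as $w_1,\dots,w_{g_f^m}$. For $x$ with $f$-expansion $(x_i)$ and $n>m$ let $\tau^f_w(x,n)=\#\{i\in\{1,\dots,n-m\}: x_i\dots x_{i+m-1}=w\}$. $A^{f,m}(x)$ denotes the set of accumulation points in $[0,1]^{g_f^m}$ of the vectors $\big(\tau^f_{w_j}(x,n)/(n-m)\big)_{j=1}^{g_f^m}$ as $n\to\infty$. *)

theory Defs
  imports "HOL-Analysis.Analysis"
begin

definition hausdorff_pre :: "real \<Rightarrow> real \<Rightarrow> real set \<Rightarrow> ennreal" where
  "hausdorff_pre s \<delta> A =
     (INF U \<in> {U :: nat \<Rightarrow> real set. A \<subseteq> (\<Union>j. U j) \<and>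
                 (\<forall>j. bounded (U j) \<and> diameter (U j) \<le> \<delta>)}.
        (\<Sum>j. ennreal (diameter (U j) powr s)))"

definition hausdorff_measure :: "real \<Rightarrow> real set \<Rightarrow> ennreal" where
  "hausdorff_measure s A = (SUP \<delta> \<in> {0<..}. hausdorff_pre s \<delta> A)"

definition hausdorff_dim :: "real set \<Rightarrow> real" where
  "hausdorff_dim A = Inf {s. 0 \<le> s \<and> hausdorff_measure s A = 0}"

text \<open>The partition of [0,1) is given by points a 0 = 0 < a 1 < ... < a g = 1;
  the k-th partition interval (digit k) is [a k, a (k+1)).\<close>
definition part_int :: "(nat \<Rightarrow> real) \<Rightarrow> nat \<Rightarrow> real set" where
  "part_int a k = {a k..<a (Suc k)}"

definition cyl :: "(nat \<Rightarrow> real) \<Rightarrow> (real \<Rightarrow> real) \<Rightarrow> nat list \<Rightarrow> real set" where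
  "cyl a f w = {x \<in> {0..<1}. \<forall>i < length w. (f ^^ i) x \<in> part_int a (w ! i)}"

definition words :: "nat \<Rightarrow> nat \<Rightarrow> nat list set" where
  "words g m = {w. length w = m \<and> set w \<subseteq> {0..<g}}"

text \<open>Setting plus condition (i). D is the derivative of f (one-sided within the
  partition interval), so the derivative of f^n at y is the chain-rule product.\<close>
definition good_map :: "nat \<Rightarrow> (nat \<Rightarrow> real) \<Rightarrow> (real \<Rightarrow> real) \<Rightarrow> bool" where
  "good_map g a f \<longleftrightarrow>
     2 \<le> g \<and> a 0 = 0 \<and> a g = 1 \<and> (\<forall>k < g. a k < a (Suc k)) \<and>
     (\<forall>k < g. (mono_on (part_int a k) f \<or> antimono_on (part_int a k) f) \<and>
              f ` part_int a k = {0..<1} \<and>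
              (\<forall>x \<in> part_int a k. \<forall>y \<in> part_int a k. \<bar>f x - f y\<bar> \<ge> \<bar>x - y\<bar>)) \<and>
     (\<forall>xs :: nat \<Rightarrow> nat. (\<forall>i. xs i < g) \<longrightarrow>
         (\<lambda>n. diameter (cyl a f (map xs [0..<n]))) \<longlonglongrightarrow> 0) \<and>
     (\<exists>D K. K > 0 \<and>
        (\<forall>k < g. \<forall>x \<in> part_int a k.
            (f has_real_derivative D x) (at x within part_int a k)) \<and>
        (\<forall>w n. w \<in> words g n \<longrightarrow> (\<forall>y \<in> cyl a f w. \<forall>z \<in> cyl a f w.
            \<bar>\<Prod>j<n. D ((f ^^ j) y)\<bar> / \<bar>\<Prod>j<n. D ((f ^^ j) z)\<bar> < K)))"

definition code :: "nat \<Rightarrow> (nat \<Rightarrow> real) \<Rightarrow> (real \<Rightarrow> real) \<Rightarrow> real \<Rightarrow> nat \<Rightarrow> nat" where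
  "code g a f x i = (THE k. k < g \<and> (f ^^ i) x \<in> part_int a k)"

text \<open>tau_w(x,n): number of positions i in 1..n-m (here 0..n-m-1) where the block of
  length m starting at i equals w.\<close>
definition tau :: "nat \<Rightarrow> (nat \<Rightarrow> real) \<Rightarrow> (real \<Rightarrow> real) \<Rightarrow> nat list \<Rightarrow> real \<Rightarrow> nat \<Rightarrow> nat" where
  "tau g a f w x n = card {i \<in> {0..<n - length w}.
       map (\<lambda>j. code g a f x (i + j)) [0..<length w] = w}"

definition freq_acc :: "nat \<Rightarrow> (nat \<Rightarrow> real) \<Rightarrow> (real \<Rightarrow> real) \<Rightarrow> nat \<Rightarrow> real \<Rightarrow> (nat list \<Rightarrow> real) \<Rightarrow> bool" where
  "freq_acc g a f m x p \<longleftrightarrow>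
     (\<exists>r :: nat \<Rightarrow> nat. strict_mono r \<and>
        (\<forall>w \<in> words g m. (\<lambda>k. real (tau g a f w x (r k)) / real (r k - m)) \<longlonglongrightarrow> p w))"

end

theory Submission
  imports Defs
begin

text \<open>Fix \<open>s\<close> strictly below all the dimensions, so \<open>s < 1\<close>. Each set \<open>E\<close> in the intersection
  has positive \<open>s\<close>-dimensional content, and it contains its preimages under \<open>f ^^ n\<close>. Every
  interval contains a cylinder of comparable length, which \<open>f ^^ n\<close> maps onto \<open>{0..<1}\<close> with
  bounded distortion. Hence the content of \<open>E\<close> in an interval is at least a constant times the
  \<open>s\<close>-th power of its length. Up to a countable set, \<open>E\<close> is a countable intersection of open sets
  defined by finitely many digits, and these inherit the lower bound.

  Measure content by covers with dyadic intervals. The optimal cost of covering a part of a dyadic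
  interval is either that of the interval itself or the sum of the costs for its halves; as
  \<open>s < 1\<close>, a uniform lower bound therefore improves by the factor \<open>2 powr (1 - s) > 1\<close> until it
  becomes the full cost of the interval. Intersecting a finite union of dyadic intervals with an
  open set that has full content everywhere does not reduce the content. By continuity of the
  content along increasing unions one can pick nested finite unions of dyadic intervals, the
  closure of the next lying in the next open set, all of content greater than \<open>1/2\<close>. By
  compactness the intersection of the closures has positive content.\<close>

section \<open>Dyadic net content\<close>

definition dyadic :: "nat \<times> nat \<Rightarrow> real set" where
  "dyadic v = {real (snd v) / 2 ^ fst v ..< real (Suc (snd v)) / 2 ^ fst v}"

text \<open>Membership becomes an equation for a floor: disjointness within one level is then
  immediate, and nesting is a matter of integer division.\<close>

lemma mem_dyadic_iff: "x \<in> dyadic (n, i) \<longleftrightarrow> 0 \<le> x \<and> nat \<lfloor>x * 2 ^ n\<rfloor> = i"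
proof -
  have "x \<in> dyadic (n, i) \<longleftrightarrow> real i \<le> x * 2 ^ n \<and> x * 2 ^ n < real i + 1"
    by (simp add: dyadic_def field_simps)
  also have "\<dots> \<longleftrightarrow> \<lfloor>x * 2 ^ n\<rfloor> = int i"
    by (simp add: floor_eq_iff)
  also have "\<dots> \<longleftrightarrow> 0 \<le> x \<and> nat \<lfloor>x * 2 ^ n\<rfloor> = i"
  proof -
    have "0 \<le> \<lfloor>x * 2 ^ n\<rfloor> \<longleftrightarrow> 0 \<le> x"
      by (simp add: zero_le_mult_iff) (smt (verit) zero_less_power)
    moreover have "k = int i \<longleftrightarrow> 0 \<le> k \<and> nat k = i" for k by auto
    ultimately show ?thesis by blast
  qed
  finally show ?thesis .
qed

lemma dyadic_nested:
  assumes "x \<in> dyadic u" "x \<in> dyadic v" "fst u \<le> fst v"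
  shows "dyadic v \<subseteq> dyadic u"
proof
  fix y assume y: "y \<in> dyadic v"
  obtain n i where u: "u = (n, i)" by force
  obtain n' j where v: "v = (n', j)" by force
  have le: "n \<le> n'" using assms u v by simp
  \<comment> \<open>The index at the coarser level is an integer quotient of the index at the finer
    level, so points that share the fine index share the coarse one.\<close>
  have coarse: "\<lfloor>z * 2 ^ n\<rfloor> = \<lfloor>z * 2 ^ n'\<rfloor> div 2 ^ (n' - n)" for z :: real
  proof -
    have "z * 2 ^ n = z * 2 ^ n' / real_of_int (2 ^ (n' - n))"
      using le by (simp add: field_simps flip: power_add)
    then show ?thesis
      by (metis floor_divide_real_eq_div zero_le_numeral zero_le_power)
  qed
  have "0 \<le> x" "0 \<le> y" "nat \<lfloor>x * 2 ^ n'\<rfloor> = j" "nat \<lfloor>y * 2 ^ n'\<rfloor> = j" "nat \<lfloor>x * 2 ^ n\<rfloor> = i"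
    using assms(1,2) y by (simp_all add: u v mem_dyadic_iff)
  moreover from this have "\<lfloor>x * 2 ^ n'\<rfloor> = \<lfloor>y * 2 ^ n'\<rfloor>"
    by (smt (verit) eq_nat_nat_iff zero_le_floor zero_le_mult_iff zero_le_power)
  ultimately show "y \<in> dyadic u"
    using coarse[of x] coarse[of y] by (simp add: u mem_dyadic_iff)
qed

lemma ex_dyadic: "0 \<le> x \<Longrightarrow> \<exists>v. fst v = n \<and> x \<in> dyadic v"
  by (rule exI[of _ "(n, nat \<lfloor>x * 2 ^ n\<rfloor>)"]) (simp add: mem_dyadic_iff)

fun lch rch :: "nat \<times> nat \<Rightarrow> nat \<times> nat" where
  "lch (n, i) = (Suc n, 2 * i)"
| "rch (n, i) = (Suc n, Suc (2 * i))"

lemma fst_lch [simp]: "fst (lch v) = Suc (fst v)" by (cases v) simp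
lemma fst_rch [simp]: "fst (rch v) = Suc (fst v)" by (cases v) simp

lemma dyadic_children: "dyadic v = dyadic (lch v) \<union> dyadic (rch v)"
  by (cases v) (auto simp: dyadic_def field_simps)

lemma dyadic_children_disjoint: "dyadic (lch v) \<inter> dyadic (rch v) = {}"
  by (cases v) (auto simp: dyadic_def field_simps)

lemma dyadic_nonempty: "\<exists>x. x \<in> dyadic v"
  by (rule exI[of _ "real (snd v) / 2 ^ fst v"]) (simp add: dyadic_def divide_strict_right_mono)

lemma dyadic_root: "dyadic (0, 0) = {0..<1}"
  by (auto simp: dyadic_def)

lemma bounded_dyadic: "bounded (dyadic v)"
  unfolding dyadic_def by (rule bounded_subset[OF bounded_closed_interval[of "real (snd v) / 2 ^ fst v" "real (Suc (snd v)) / 2 ^ fst v"]]) auto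

lemma dyadic_dist: "x \<in> dyadic v \<Longrightarrow> y \<in> dyadic v \<Longrightarrow> \<bar>x - y\<bar> \<le> (1/2) ^ fst v"
  by (auto simp: dyadic_def abs_le_iff field_simps)

lemma diameter_dyadic: "diameter (dyadic v) \<le> (1/2) ^ fst v"
  by (rule diameter_le) (auto simp: dist_real_def dyadic_dist)

section \<open>Weights of nodes and the content they define\<close>

definition wt :: "real \<Rightarrow> nat \<times> nat \<Rightarrow> ennreal" where
  "wt s v = ennreal (((1/2) ^ fst v) powr s)"

lemma wt_antimono: "0 \<le> s \<Longrightarrow> fst u \<le> fst v \<Longrightarrow> wt s v \<le> wt s u"
  unfolding wt_def by (intro ennreal_leI powr_mono2) (auto intro: power_decreasing)

text \<open>As a measure on nodes, the cost of a cover comes with subadditivity, additivity over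
  disjoint families and continuity from below.\<close>

definition nodem :: "real \<Rightarrow> (nat \<times> nat) measure" where
  "nodem s = point_measure UNIV (wt s)"

lemma sets_nodem [simp, measurable]: "U \<in> sets (nodem s)"
  by (simp add: nodem_def)

lemma emeasure_nodem_singleton: "emeasure (nodem s) {v} = wt s v"
  by (simp add: nodem_def emeasure_point_measure_finite2)

text \<open>The dyadic analogue of Hausdorff content: covers may use intervals of any level.\<close>

definition net :: "real \<Rightarrow> real set \<Rightarrow> ennreal" where
  "net s A = (INF U \<in> {U. A \<subseteq> \<Union>(dyadic ` U)}. emeasure (nodem s) U)"

lemma net_le: "A \<subseteq> \<Union>(dyadic ` U) \<Longrightarrow> net s A \<le> emeasure (nodem s) U"
  unfolding net_def by (rule INF_lower) simp

lemma net_geI: "(\<And>U. A \<subseteq> \<Union>(dyadic ` U) \<Longrightarrow> c \<le> emeasure (nodem s) U) \<Longrightarrow> c \<le> net s A"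
  unfolding net_def by (rule INF_greatest) simp

lemma net_mono: "A \<subseteq> B \<Longrightarrow> net s A \<le> net s B"
  by (rule net_geI) (rule net_le, blast)

lemma net_empty [simp]: "net s {} = 0"
  using net_le[of "{}" "{}" s] by simp

lemma net_Int_dyadic_le: "net s (A \<inter> dyadic v) \<le> wt s v"
  using net_le[of "A \<inter> dyadic v" "{v}" s] by (simp add: emeasure_nodem_singleton)

lemma net_approx:
  assumes "net s A \<noteq> \<infinity>" "0 < e"
  obtains U where "A \<subseteq> \<Union>(dyadic ` U)" "emeasure (nodem s) U < net s A + ennreal e"
  using INF_approx_ennreal[OF assms(2) net_def assms(1)] by blast

lemma net_Un: "net s (A \<union> B) \<le> net s A + net s B"
proof (rule ennreal_le_epsilon)
  fix e :: real assume fin: "net s A + net s B < top" and e: "0 < e"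
  obtain U where U: "A \<subseteq> \<Union>(dyadic ` U)" "emeasure (nodem s) U < net s A + ennreal (e/2)"
    using net_approx[of s A "e/2"] fin e by (auto simp: less_top)
  obtain W where W: "B \<subseteq> \<Union>(dyadic ` W)" "emeasure (nodem s) W < net s B + ennreal (e/2)"
    using net_approx[of s B "e/2"] fin e by (auto simp: less_top)
  have "net s (A \<union> B) \<le> emeasure (nodem s) (U \<union> W)"
    using U W by (intro net_le) blast
  also have "\<dots> \<le> emeasure (nodem s) U + emeasure (nodem s) W"
    by (rule emeasure_subadditive) auto
  also have "\<dots> \<le> (net s A + ennreal (e/2)) + (net s B + ennreal (e/2))"
    using U W by (intro add_mono) auto
  also have "\<dots> = net s A + net s B + ennreal e"
    using e by (simp add: add_ac flip: ennreal_plus)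
  finally show "net s (A \<union> B) \<le> net s A + net s B + ennreal e" .
qed

lemma net_split_le:
  "net s (A \<inter> dyadic v) \<le> net s (A \<inter> dyadic (lch v)) + net s (A \<inter> dyadic (rch v))"
  using net_Un[of s "A \<inter> dyadic (lch v)" "A \<inter> dyadic (rch v)"]
  by (subst dyadic_children) (simp add: Int_Un_distrib)

text \<open>If a cover uses a node meeting \<open>dyadic v\<close> at level \<open>fst v\<close> or
  above, that node alone costs at least \<open>wt s v\<close>. Otherwise every relevant node is
  strictly deeper, lies in one of the two children by nesting, and the cover splits into covers of
  the two halves. With \<open>net_Int_dyadic_le\<close> and \<open>net_split_le\<close> this yields
  an exact recursion.\<close>

lemma net_split_ge:
  assumes "0 \<le> s"
  shows "min (wt s v) (net s (A \<inter> dyadic (lch v)) + net s (A \<inter> dyadic (rch v)))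
           \<le> net s (A \<inter> dyadic v)"
proof (rule net_geI)
  fix U assume U: "A \<inter> dyadic v \<subseteq> \<Union>(dyadic ` U)"
  show "min (wt s v) (net s (A \<inter> dyadic (lch v)) + net s (A \<inter> dyadic (rch v)))
          \<le> emeasure (nodem s) U"
  proof (cases "\<exists>u\<in>U. fst u \<le> fst v \<and> dyadic u \<inter> dyadic v \<noteq> {}")
    case True
    then obtain u where u: "u \<in> U" "fst u \<le> fst v" by blast
    have "wt s v \<le> wt s u" by (rule wt_antimono[OF assms u(2)])
    also have "\<dots> \<le> emeasure (nodem s) U"
      using u(1) by (subst emeasure_nodem_singleton[symmetric]) (intro emeasure_mono, auto)
    finally show ?thesis by (simp add: min.coboundedI1)
  next
    case False
    have part: "A \<inter> dyadic c \<subseteq> \<Union>(dyadic ` {u\<in>U. dyadic u \<subseteq> dyadic c})"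
      if c: "dyadic c \<subseteq> dyadic v" "fst c = Suc (fst v)" for c
    proof
      fix x assume x: "x \<in> A \<inter> dyadic c"
      with U c(1) obtain u where u: "u \<in> U" "x \<in> dyadic u" by blast
      with False x c(1) have "fst v < fst u" by (meson IntI disjoint_iff not_less subsetD IntD2)
      then have "dyadic u \<subseteq> dyadic c"
        using dyadic_nested[of x c u] x u(2) c(2) by auto
      with u show "x \<in> \<Union>(dyadic ` {u\<in>U. dyadic u \<subseteq> dyadic c})" by blast
    qed
    let ?L = "{u\<in>U. dyadic u \<subseteq> dyadic (lch v)}" and ?R = "{u\<in>U. dyadic u \<subseteq> dyadic (rch v)}"
    \<comment> \<open>Dyadic intervals are nonempty, so none lies in both children; hence the two
      costs add up without counting a node twice.\<close>
    have disj: "?L \<inter> ?R = {}"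
      using dyadic_children_disjoint[of v] dyadic_nonempty by blast
    have "net s (A \<inter> dyadic (lch v)) + net s (A \<inter> dyadic (rch v))
        \<le> emeasure (nodem s) ?L + emeasure (nodem s) ?R"
      using dyadic_children[of v] by (intro add_mono net_le part) auto
    also have "\<dots> = emeasure (nodem s) (?L \<union> ?R)"
      by (rule plus_emeasure) (use disj in auto)
    also have "\<dots> \<le> emeasure (nodem s) U"
      by (rule emeasure_mono) auto
    finally show ?thesis by (simp add: min.coboundedI2)
  qed
qed

lemma wt_children: "wt s (lch v) + wt s (rch v) = ennreal (2 powr (1 - s)) * wt s v"
proof -
  have "((1/2) ^ Suc n) powr s + ((1/2) ^ Suc n) powr s = 2 powr (1 - s) * ((1/2) ^ n) powr s"
    for n :: nat
    by (simp add: powr_mult powr_divide powr_diff)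
  then show ?thesis
    by (simp add: wt_def flip: ennreal_plus ennreal_mult del: power_Suc)
qed

lemma dyadic_child_subset:
  "dyadic (lch v) \<subseteq> dyadic v" "dyadic (rch v) \<subseteq> dyadic v"
  using dyadic_children[of v] by auto

text \<open>Each passage from the two halves to their parent multiplies the constant by
  \<open>q > 1\<close>, capped at 1 because the parent may be covered by itself. Since
  \<open>lb\<close> holds with the same \<open>c\<close> at every node, the passage can be iterated
  until \<open>c * q ^ n\<close> exceeds 1.\<close>

lemma net_full:
  assumes s: "0 \<le> s" "s < 1" and c: "0 < c"
    and lb: "\<And>v. dyadic v \<subseteq> {0..<1} \<Longrightarrow> ennreal c * wt s v \<le> net s (V \<inter> dyadic v)"
    and v: "dyadic v \<subseteq> {0..<1}"
  shows "wt s v \<le> net s (V \<inter> dyadic v)"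
proof -
  define q where "q = 2 powr (1 - s)"
  have q: "1 < q" using s by (simp add: q_def)
  have iter: "ennreal (min 1 (c * q ^ n)) * wt s v \<le> net s (V \<inter> dyadic v)"
    if "dyadic v \<subseteq> {0..<1}" for n v
    using that
  proof (induction n arbitrary: v)
    case 0
    have "ennreal (min 1 (c * q ^ 0)) * wt s v \<le> ennreal c * wt s v"
      by (intro mult_right_mono ennreal_leI) auto
    with lb[OF 0] show ?case by (rule order_trans[rotated])
  next
    case (Suc n)
    have ge: "ennreal (min 1 (c * q ^ n)) * wt s w \<le> net s (V \<inter> dyadic w)"
      if "w = lch v \<or> w = rch v" for w
      using Suc.prems dyadic_child_subset[of v] that by (intro Suc.IH) auto
    have "ennreal (min 1 (c * q ^ Suc n)) * wt s v
        \<le> min (wt s v) (ennreal (min 1 (c * q ^ n) * q) * wt s v)"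
    proof (rule min.boundedI)
      show "ennreal (min 1 (c * q ^ Suc n)) * wt s v \<le> wt s v"
        using mult_right_mono[of "ennreal (min 1 (c * q ^ Suc n))" 1 "wt s v"] 
        by (simp add: ennreal_le_1)
      have "min 1 (c * q ^ Suc n) \<le> min 1 (c * q ^ n) * q"
      proof (cases "c * q ^ n \<le> 1")
        case True
        then show ?thesis by (simp add: mult_ac)
      next
        case False
        then show ?thesis using q by simp
      qed
      then show "ennreal (min 1 (c * q ^ Suc n)) * wt s v \<le> ennreal (min 1 (c * q ^ n) * q) * wt s v"
        by (intro mult_right_mono ennreal_leI) auto
    qed
    also have "ennreal (min 1 (c * q ^ n) * q) * wt s v
        = ennreal (min 1 (c * q ^ n)) * (wt s (lch v) + wt s (rch v))"
      using c q by (subst wt_children) (simp add: q_def ennreal_mult mult.assoc)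
    also have "min (wt s v) \<dots> \<le> min (wt s v) (net s (V \<inter> dyadic (lch v)) + net s (V \<inter> dyadic (rch v)))"
      by (intro min.mono order_refl) (auto simp: distrib_left intro!: add_mono ge)
    also have "\<dots> \<le> net s (V \<inter> dyadic v)"
      by (rule net_split_ge[OF s(1)])
    finally show ?case .
  qed
  obtain n where "1 / c < q ^ n" using real_arch_pow[OF q] by blast
  then have "min 1 (c * q ^ n) = 1" using c by (simp add: field_simps min_def)
  with iter[OF v, of n] show ?thesis by simp
qed

section \<open>Continuity of the net content along increasing unions\<close>

text \<open>The nodes at which the descent through the tree first meets \<open>wt s u \<le> h u\<close>.\<close>
fun stop :: "real \<Rightarrow> (nat \<times> nat \<Rightarrow> ennreal) \<Rightarrow> nat \<Rightarrow> nat \<times> nat \<Rightarrow> (nat \<times> nat) set" where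
  "stop s h 0 v = (if wt s v \<le> h v then {v} else {})"
| "stop s h (Suc d) v =
     (if wt s v \<le> h v then {v} else stop s h d (lch v) \<union> stop s h d (rch v))"

text \<open>A larger depth bound only continues the descent at nodes where it was cut off.\<close>

lemma stop_incseq: "incseq (\<lambda>d. stop s h d v)"
proof -
  have "stop s h d v \<subseteq> stop s h (Suc d) v" for d v
  proof (induction d arbitrary: v)
    case (Suc d)
    show ?case using Suc[of "lch v"] Suc[of "rch v"] by auto
  qed auto
  then show ?thesis by (intro incseq_SucI)
qed

text \<open>Where the descent goes on, \<open>wt s v\<close> exceeds \<open>h v\<close>, so the
  minimum in the hypothesis must be the sum over the children, and the budget \<open>h v\<close>
  pays for both subtrees.\<close>

lemma emeasure_stop_le:
  assumes "\<And>u. min (wt s u) (h (lch u) + h (rch u)) \<le> h u"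
  shows "emeasure (nodem s) (stop s h d v) \<le> h v"
proof (induction d arbitrary: v)
  case 0
  show ?case by (simp add: emeasure_nodem_singleton)
next
  case (Suc d)
  show ?case
  proof (cases "wt s v \<le> h v")
    case True
    then show ?thesis by (simp add: emeasure_nodem_singleton)
  next
    case False
    have "emeasure (nodem s) (stop s h d (lch v) \<union> stop s h d (rch v)) \<le> h (lch v) + h (rch v)"
      by (rule order_trans[OF emeasure_subadditive add_mono]) (use Suc in auto)
    also have "\<dots> \<le> h v"
      using assms[of v] False by (auto simp: min_le_iff_disj)
    finally show ?thesis using False by simp
  qed
qed

text \<open>The descent along the path of \<open>x\<close> meets the stopping criterion at
  \<open>u\<close> at the latest.\<close>

lemma mem_stop:
  assumes "x \<in> dyadic v" "x \<in> dyadic u" "fst u = fst v + d" "wt s u \<le> h u"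
  shows "x \<in> \<Union>(dyadic ` stop s h d v)"
  using assms
proof (induction d arbitrary: v)
  case 0
  then have "u = v" by (cases u, cases v) (auto simp: mem_dyadic_iff)
  with 0 show ?case by simp
next
  case (Suc d)
  from Suc.prems(1) consider "x \<in> dyadic (lch v)" | "x \<in> dyadic (rch v)"
    using dyadic_children[of v] by blast
  then have "x \<in> \<Union>(dyadic ` (stop s h d (lch v) \<union> stop s h d (rch v)))"
    by cases (use Suc.IH[of "lch v"] Suc.IH[of "rch v"] Suc.prems in auto)
  with Suc.prems(1) show ?case by auto
qed

text \<open>The stopping nodes for \<open>h\<close>, the supremum of the contents, form a single
  cover of the union: a point of \<open>B n\<close> lies in a small dyadic interval inside
  \<open>B n\<close>, whose content is at least its weight, so the criterion holds there. At every
  depth the cost is at most \<open>h v\<close>, hence also in the limit.\<close>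

lemma net_incseq:
  assumes s: "0 \<le> s"
    and inc: "incseq B"
    and dy: "\<And>n x. x \<in> B n \<Longrightarrow> \<exists>k. \<forall>u. k \<le> fst u \<longrightarrow> x \<in> dyadic u \<longrightarrow> dyadic u \<subseteq> B n"
    and full: "\<And>u n. dyadic u \<subseteq> B n \<Longrightarrow> wt s u \<le> net s (dyadic u)"
    and nonneg: "\<And>n. B n \<subseteq> {0..}"
  shows "net s ((\<Union>n. B n) \<inter> dyadic v) \<le> (SUP n. net s (B n \<inter> dyadic v))"
proof -
  define h where "h u = (SUP n. net s (B n \<inter> dyadic u))" for u
  have inc_net: "incseq (\<lambda>n. net s (B n \<inter> dyadic u))" for u
    using inc by (auto simp: incseq_def intro!: net_mono)
  \<comment> \<open>The splitting inequality passes to \<open>h\<close> because sums and minima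
    commute with suprema of increasing sequences.\<close>
  have h: "min (wt s u) (h (lch u) + h (rch u)) \<le> h u" for u
  proof -
    have "h (lch u) + h (rch u)
        = (SUP n. net s (B n \<inter> dyadic (lch u)) + net s (B n \<inter> dyadic (rch u)))"
      unfolding h_def by (rule ennreal_SUP_add[symmetric]) (rule inc_net)+
    then have "min (wt s u) (h (lch u) + h (rch u))
        = (SUP n. min (wt s u) (net s (B n \<inter> dyadic (lch u)) + net s (B n \<inter> dyadic (rch u))))"
      by (simp add: inf_min[symmetric] inf_SUP)
    also have "\<dots> \<le> h u"
      unfolding h_def by (intro SUP_mono) (use net_split_ge[OF s] in blast)
    finally show ?thesis .
  qed
  have "(\<Union>n. B n) \<inter> dyadic v \<subseteq> \<Union>(dyadic ` (\<Union>d. stop s h d v))"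
  proof
    fix x assume "x \<in> (\<Union>n. B n) \<inter> dyadic v"
    then obtain n where x: "x \<in> B n" "x \<in> dyadic v" by blast
    from dy[OF x(1)] obtain k where k: "\<And>u. k \<le> fst u \<Longrightarrow> x \<in> dyadic u \<Longrightarrow> dyadic u \<subseteq> B n"
      by blast
    obtain u where u: "fst u = fst v + k" "x \<in> dyadic u"
      using ex_dyadic[of x "fst v + k"] nonneg x by fastforce
    have sub: "dyadic u \<subseteq> B n" using k u by simp
    have "wt s u \<le> net s (B n \<inter> dyadic u)"
      using full[OF sub] sub by (simp add: Int_absorb1)
    also have "\<dots> \<le> h u" unfolding h_def by (rule SUP_upper) simp
    finally show "x \<in> \<Union>(dyadic ` (\<Union>d. stop s h d v))"
      using mem_stop[OF x(2) u(2,1)] by blast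
  qed
  then have "net s ((\<Union>n. B n) \<inter> dyadic v) \<le> emeasure (nodem s) (\<Union>d. stop s h d v)"
    by (rule net_le)
  also have "\<dots> = (SUP d. emeasure (nodem s) (stop s h d v))"
    by (rule SUP_emeasure_incseq[symmetric]) (auto simp: stop_incseq)
  also have "\<dots> \<le> h v"
    by (intro SUP_least emeasure_stop_le h)
  finally show ?thesis by (simp add: h_def)
qed

section \<open>Finite unions of dyadic intervals and sets of full content\<close>

definition gridset :: "nat \<Rightarrow> real set \<Rightarrow> bool" where
  "gridset n A \<longleftrightarrow> A \<subseteq> {0..<1} \<and> (\<forall>v. fst v = n \<longrightarrow> dyadic v \<subseteq> A \<or> dyadic v \<inter> A = {})"

text \<open>By \<open>net_Int_dyadic_le\<close> the inequality is an equality: \<open>V\<close> has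
  the largest possible content in every dyadic subinterval.\<close>

definition full :: "real \<Rightarrow> real set \<Rightarrow> bool" where
  "full s V \<longleftrightarrow> (\<forall>v. dyadic v \<subseteq> {0..<1} \<longrightarrow> wt s v \<le> net s (V \<inter> dyadic v))"

lemma full_dyadic: "full s V \<Longrightarrow> dyadic v \<subseteq> {0..<1} \<Longrightarrow> wt s v \<le> net s (dyadic v)"
  unfolding full_def by (meson Int_lower2 net_mono order_trans)

text \<open>At level \<open>n\<close> a node lies in \<open>A\<close>, where fullness of
  \<open>V\<close> applies, or misses \<open>A\<close>. Going up from there, the upper bound for
  \<open>A\<close> and the lower bound for \<open>V \<inter> A\<close> are the same expression in
  the contents of the children.\<close>

lemma net_full_Int:
  assumes s: "0 \<le> s" and V: "full s V" and A: "gridset n A" and v: "fst v \<le> n"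
  shows "net s (A \<inter> dyadic v) \<le> net s (V \<inter> A \<inter> dyadic v)"
  using v
proof (induction "n - fst v" arbitrary: v)
  case 0
  then have "fst v = n" by simp
  then consider "dyadic v \<subseteq> A" | "A \<inter> dyadic v = {}"
    using A unfolding gridset_def by blast
  then show ?case
  proof cases
    case 1
    then have "net s (A \<inter> dyadic v) \<le> wt s v" "V \<inter> A \<inter> dyadic v = V \<inter> dyadic v"
      using net_Int_dyadic_le by auto
    with 1 A V show ?thesis
      unfolding full_def gridset_def by (metis order_trans)
  qed simp
next
  case (Suc d)
  have "net s (A \<inter> dyadic v)
      \<le> min (wt s v) (net s (A \<inter> dyadic (lch v)) + net s (A \<inter> dyadic (rch v)))"
    by (simp add: net_Int_dyadic_le net_split_le)
  also have "\<dots> \<le> min (wt s v)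
      (net s (V \<inter> A \<inter> dyadic (lch v)) + net s (V \<inter> A \<inter> dyadic (rch v)))"
    using Suc by (intro min.mono add_mono order_refl Suc.hyps) auto
  also have "\<dots> \<le> net s (V \<inter> A \<inter> dyadic v)"
    by (rule net_split_ge[OF s])
  finally show ?case .
qed

lemma gridset_mono:
  assumes A: "gridset n A" and le: "n \<le> k"
  shows "gridset k A"
  unfolding gridset_def
proof (intro conjI allI impI)
  show sub: "A \<subseteq> {0..<1}" using A by (simp add: gridset_def)
  fix v :: "nat \<times> nat" assume v: "fst v = k"
  show "dyadic v \<subseteq> A \<or> dyadic v \<inter> A = {}"
  proof (rule disjCI)
    assume "dyadic v \<inter> A \<noteq> {}"
    then obtain x where x: "x \<in> dyadic v" "x \<in> A" by blast
    then have "0 \<le> x" using sub by auto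
    then obtain u where u: "fst u = n" "x \<in> dyadic u" using ex_dyadic by blast
    have "dyadic v \<subseteq> dyadic u"
      using dyadic_nested[OF u(2) x(1)] u(1) v le by simp
    moreover have "dyadic u \<subseteq> A" using A u x unfolding gridset_def by blast
    ultimately show "dyadic v \<subseteq> A" by blast
  qed
qed

lemma finite_dyadic_level: "finite {v. fst v = n \<and> dyadic v \<subseteq> {0..<1}}"
proof (rule finite_subset)
  show "{v. fst v = n \<and> dyadic v \<subseteq> {0..<1}} \<subseteq> {n} \<times> {..<2 ^ n}"
  proof clarsimp
    fix i assume "dyadic (n, i) \<subseteq> {0..<1}"
    moreover have "real i / 2 ^ n \<in> dyadic (n, i)" by (simp add: dyadic_def divide_strict_right_mono)
    ultimately have "real i / 2 ^ n < 1" by auto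
    then have "real i < real (2 ^ n)" by simp
    then show "i < 2 ^ n" by (simp only: of_nat_less_iff)
  qed
qed auto

text \<open>The sets \<open>B k\<close> collect the level \<open>k\<close> intervals inside
  \<open>A\<close> whose closure lies in \<open>V\<close>. They increase and, \<open>V\<close> being
  open, exhaust \<open>V \<inter> A\<close>, whose content is at least that of \<open>A\<close>; by
  \<open>net_incseq\<close> some \<open>B k\<close> already exceeds \<open>m\<close>.\<close>

lemma net_refine:
  assumes s: "0 \<le> s" and V: "full s V" "open V" and A: "gridset n A" and m: "m < net s A"
  obtains n' A' where "gridset n' A'" "A' \<subseteq> A" "closure A' \<subseteq> V" "m < net s A'"
proof -
  define N where "N k = {v. fst v = k \<and> closure (dyadic v) \<subseteq> V \<and> dyadic v \<subseteq> A}" for k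
  define B where "B k = \<Union>(dyadic ` N k)" for k
  have A01: "A \<subseteq> {0..<1}" using A by (simp add: gridset_def)
  have BA: "B k \<subseteq> A" for k by (auto simp: B_def N_def)
  \<comment> \<open>Descendants of a selected interval are selected again at their own level; this
    gives both monotonicity of \<open>B\<close> and its grid structure.\<close>
  have descend: "dyadic u \<subseteq> B (fst u)" if "x \<in> B k" "x \<in> dyadic u" "k \<le> fst u" for x k u
  proof -
    from that obtain v where v: "v \<in> N k" "x \<in> dyadic v" by (auto simp: B_def)
    then have "dyadic u \<subseteq> dyadic v"
      using that by (intro dyadic_nested[of x]) (auto simp: N_def)
    with v(1) have "u \<in> N (fst u)"
      using closure_mono[of "dyadic u" "dyadic v"] by (auto simp: N_def)
    then show ?thesis by (auto simp: B_def)
  qed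
  have inc: "incseq B"
  proof (rule incseq_SucI, rule subsetI)
    fix k x assume x: "x \<in> B k"
    with BA A01 have "0 \<le> x" by fastforce
    then obtain u where "fst u = Suc k" "x \<in> dyadic u" using ex_dyadic by blast
    with descend[OF x, of u] show "x \<in> B (Suc k)" by auto
  qed
  have grid: "gridset k (B k)" for k
    unfolding gridset_def
  proof (intro conjI allI impI)
    show "B k \<subseteq> {0..<1}" using BA A01 by blast
    show "dyadic v \<subseteq> B k \<or> dyadic v \<inter> B k = {}" if "fst v = k" for v
      using descend[of _ k v] that by blast
  qed
  have cl: "closure (B k) \<subseteq> V" for k
  proof -
    \<comment> \<open>Finiteness lets the closure distribute over the union.\<close>
    have "finite (N k)"
      by (rule finite_subset[OF _ finite_dyadic_level[of k]]) (use A01 in \<open>auto simp: N_def\<close>)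
    then have "closure (B k) = (\<Union>v\<in>N k. closure (dyadic v))"
      unfolding B_def by (induction rule: finite_induct) (auto simp: closure_Un)
    then show ?thesis by (auto simp: N_def)
  qed
  have Un: "V \<inter> A \<subseteq> (\<Union>k. B k)"
  proof
    fix x assume x: "x \<in> V \<inter> A"
    then obtain e where e: "e > 0" "cball x e \<subseteq> V"
      using V(2) open_contains_cball by blast
    obtain k0 where k0: "(1/2::real) ^ k0 < e" using real_arch_pow_inv[OF e(1)] by force
    \<comment> \<open>Level \<open>n\<close> makes the interval around \<open>x\<close> respect
      \<open>A\<close>; level \<open>k0\<close> makes it fit into the closed ball inside
      \<open>V\<close>, which then contains its closure too.\<close>
    define k where "k = max n k0"
    have "(1/2::real) ^ k \<le> (1/2) ^ k0" unfolding k_def by (rule power_decreasing) auto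
    with k0 have k: "(1/2::real) ^ k < e" by linarith
    have "0 \<le> x" using x A01 by auto
    then obtain v where v: "fst v = k" "x \<in> dyadic v" using ex_dyadic by blast
    have "dyadic v \<subseteq> A"
      using gridset_mono[OF A, of k] v x unfolding gridset_def k_def
      by (meson IntD2 disjoint_iff max.cobounded1)
    moreover have "dyadic v \<subseteq> cball x e"
      using dyadic_dist[OF v(2)] k v(1) by (fastforce simp: dist_real_def)
    then have "closure (dyadic v) \<subseteq> V"
      using e(2) closure_minimal[OF _ closed_cball] by blast
    ultimately show "x \<in> (\<Union>k. B k)" using v unfolding B_def N_def by blast
  qed
  have root: "X \<inter> dyadic (0, 0) = X" if "X \<subseteq> A" for X
    using that A01 by (auto simp: dyadic_root)
  have "net s A \<le> net s (V \<inter> A)"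
    using net_full_Int[OF s V(1) A, of "(0, 0)"] root[of A] root[of "V \<inter> A"] by simp
  also have "\<dots> \<le> net s ((\<Union>k. B k) \<inter> dyadic (0, 0))"
    using Un root[of "V \<inter> A"] by (intro net_mono) blast
  also have "\<dots> \<le> (SUP k. net s (B k \<inter> dyadic (0, 0)))"
  proof (rule net_incseq[OF s inc])
    fix k x assume x: "x \<in> B k"
    have "dyadic u \<subseteq> B k" if "k \<le> fst u" "x \<in> dyadic u" for u
      using gridset_mono[OF grid that(1)] that(2) x unfolding gridset_def by blast
    then show "\<exists>j. \<forall>u. j \<le> fst u \<longrightarrow> x \<in> dyadic u \<longrightarrow> dyadic u \<subseteq> B k" by blast
  next
    fix u k assume "dyadic u \<subseteq> B k"
    then show "wt s u \<le> net s (dyadic u)"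
      using BA A01 by (intro full_dyadic[OF V(1)]) blast
  next
    show "B k \<subseteq> {0..}" for k using BA A01 by fastforce
  qed
  finally have "m < (SUP k. net s (B k))"
    using m root[OF BA] by simp
  then obtain k where "m < net s (B k)" by (auto simp: less_SUP_iff)
  then show thesis using that grid BA cl by blast
qed

section \<open>Compactness, and comparison with covers by open intervals\<close>

lemma compact_family_subset:
  fixes A :: "nat \<Rightarrow> 'a::heine_borel set"
  assumes "\<And>k. compact (A k)" "\<And>k. A (Suc k) \<subseteq> A k" "open G" "(\<Inter>k. A k) \<subseteq> G"
  shows "\<exists>k. A k \<subseteq> G"
proof (rule ccontr)
  assume "\<not> ?thesis"
  then have "A k - G \<noteq> {}" for k by blast
  then have "(\<Inter>k. A k - G) \<noteq> {}"
    using assms lift_Suc_antimono_le[of A] by (intro compact_nest compact_diff) blast+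
  with assms(4) show False by blast
qed

text \<open>With \<open>n\<close> chosen so that the length lies in
  \<open>((1/2) ^ Suc n, (1/2) ^ n]\<close>, an interval meets at most two neighbouring level
  \<open>n\<close> nodes in the nonnegative axis. Each has weight at most
  \<open>2 powr s <= 2\<close> times the cost of the interval, hence the factor 4. Length at most 1
  guarantees that such an \<open>n\<close> exists.\<close>

lemma net_cover_le:
  assumes s: "0 \<le> s" "s \<le> 1"
    and cover: "A \<subseteq> (\<Union>j::nat. {x j<..<y j})" and A: "A \<subseteq> {0..}"
    and len: "\<And>j. x j < y j" "\<And>j. y j - x j \<le> 1"
  shows "net s A \<le> 4 * (\<Sum>j. ennreal ((y j - x j) powr s))"
proof -
  have "\<exists>u u'. A \<inter> {x j<..<y j} \<subseteq> dyadic u \<union> dyadic u' \<and>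
      wt s u \<le> 2 * ennreal ((y j - x j) powr s) \<and> wt s u' \<le> 2 * ennreal ((y j - x j) powr s)" for j
  proof -
    obtain n where n: "(1/2) ^ Suc n < y j - x j" "y j - x j \<le> (1/2) ^ n"
    proof -
      define P where "P n \<longleftrightarrow> (1/2) ^ Suc n < y j - x j" for n
      have "\<exists>n. P n"
      proof -
        obtain k where k: "(1/2) ^ k < y j - x j"
          using real_arch_pow_inv[of "y j - x j" "1/2"] len[of j] by auto
        have "(1/2::real) ^ Suc k \<le> (1/2) ^ k" by (rule power_decreasing) auto
        with k show ?thesis
          unfolding P_def by (intro exI[of _ k]) linarith
      qed
      then have L: "P (LEAST n. P n)" by (rule LeastI_ex)
      show thesis
      proof (rule that[of "LEAST n. P n"])
        show "(1/2) ^ Suc (LEAST n. P n) < y j - x j" using L by (simp add: P_def)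
        show "y j - x j \<le> (1/2) ^ (LEAST n. P n)"
        proof (cases "LEAST n. P n")
          case 0
          then show ?thesis using len by simp
        next
          case (Suc k)
          then have "\<not> P k" using not_less_Least[of k P] by simp
          then show ?thesis using Suc by (simp add: P_def)
        qed
      qed
    qed
    \<comment> \<open>For negative \<open>x j\<close> the truncation by \<open>nat\<close> gives 0,
      which is correct: a point \<open>z >= 0\<close> of the interval then has floor 0.\<close>
    define i where "i = nat \<lfloor>x j * 2 ^ n\<rfloor>"
    have "A \<inter> {x j<..<y j} \<subseteq> dyadic (n, i) \<union> dyadic (n, Suc i)"
    proof
      fix z assume "z \<in> A \<inter> {x j<..<y j}"
      with A have z: "0 \<le> z" "x j < z" "z < y j" by auto
      have *: "x j * 2 ^ n \<le> z * 2 ^ n" using z by simp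
      have "(z - x j) * 2 ^ n \<le> (1/2) ^ n * 2 ^ n"
        using z n(2) by (intro mult_right_mono) auto
      then have **: "z * 2 ^ n \<le> x j * 2 ^ n + 1"
        by (simp add: algebra_simps power_one_over)
      have "\<lfloor>z * 2 ^ n\<rfloor> = \<lfloor>x j * 2 ^ n\<rfloor> \<or> \<lfloor>z * 2 ^ n\<rfloor> = \<lfloor>x j * 2 ^ n\<rfloor> + 1"
        using * ** floor_mono[OF *] floor_mono[OF **] by linarith
      moreover have "0 \<le> \<lfloor>z * 2 ^ n\<rfloor>" using z by simp
      ultimately have "nat \<lfloor>z * 2 ^ n\<rfloor> = i \<or> nat \<lfloor>z * 2 ^ n\<rfloor> = Suc i"
        unfolding i_def by linarith
      with z show "z \<in> dyadic (n, i) \<union> dyadic (n, Suc i)"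
        by (auto simp: mem_dyadic_iff)
    qed
    moreover have "((1/2) ^ n) powr s \<le> 2 * (y j - x j) powr s"
    proof -
      have "((1/2) ^ n) powr s \<le> (2 * (y j - x j)) powr s"
        using n(1) s by (intro powr_mono2) auto
      also have "\<dots> = 2 powr s * (y j - x j) powr s"
        by (rule powr_mult)
      also have "\<dots> \<le> 2 * (y j - x j) powr s"
        using s powr_mono[of s 1 2] by (intro mult_right_mono) auto
      finally show ?thesis .
    qed
    then have "wt s (n, k) \<le> 2 * ennreal ((y j - x j) powr s)" for k
      unfolding wt_def by (simp add: ennreal_leI flip: ennreal_mult''[of _ 2, simplified])
    ultimately show ?thesis by blast
  qed
  then obtain u u' where u: "\<And>j. A \<inter> {x j<..<y j} \<subseteq> dyadic (u j) \<union> dyadic (u' j)"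
    "\<And>j. wt s (u j) \<le> 2 * ennreal ((y j - x j) powr s)"
    "\<And>j. wt s (u' j) \<le> 2 * ennreal ((y j - x j) powr s)"
    by metis
  have "net s A \<le> emeasure (nodem s) (\<Union>j. {u j, u' j})"
    using cover u(1) by (intro net_le) fastforce
  also have "\<dots> \<le> (\<Sum>j. emeasure (nodem s) {u j, u' j})"
    by (rule emeasure_subadditive_countably) auto
  also have "\<dots> \<le> (\<Sum>j. 4 * ennreal ((y j - x j) powr s))"
  proof (intro suminf_le)
    fix j
    have "emeasure (nodem s) {u j, u' j} \<le> wt s (u j) + wt s (u' j)"
      using emeasure_subadditive[of "{u j}" "nodem s" "{u' j}"]
      by (simp add: emeasure_nodem_singleton insert_commute)
    also have "\<dots> \<le> 2 * ennreal ((y j - x j) powr s) + 2 * ennreal ((y j - x j) powr s)"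
      using u by (intro add_mono) auto
    also have "\<dots> = 4 * ennreal ((y j - x j) powr s)"
      by (simp flip: distrib_right)
    finally show "emeasure (nodem s) {u j, u' j} \<le> 4 * ennreal ((y j - x j) powr s)" .
  qed auto
  also have "\<dots> = 4 * (\<Sum>j. ennreal ((y j - x j) powr s))"
    by (rule ennreal_suminf_cmult)
  finally show ?thesis .
qed

section \<open>Cylinders and bounded distortion\<close>

text \<open>The endpoints are the preimages of \<open>l\<close> and \<open>r\<close>, except that 1
  is not a value of \<open>h\<close>; for \<open>r = 1\<close> the endpoint \<open>\<beta>\<close>
  takes its place.\<close>

lemma strict_mono_on_vimage_Ico:
  fixes h :: "real \<Rightarrow> real"
  assumes h: "strict_mono_on {\<alpha>..<\<beta>} h" "h ` {\<alpha>..<\<beta>} = {0..<1}"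
    and lr: "0 \<le> l" "l < r" "r \<le> 1"
  obtains l' r' where "\<alpha> \<le> l'" "l' < r'" "r' \<le> \<beta>" "{x \<in> {\<alpha>..<\<beta>}. h x \<in> {l..<r}} = {l'..<r'}"
proof -
  have less: "h x < h y \<longleftrightarrow> x < y" if "x \<in> {\<alpha>..<\<beta>}" "y \<in> {\<alpha>..<\<beta>}" for x y
    using h(1) that by (rule strict_mono_on_less)
  have "l \<in> h ` {\<alpha>..<\<beta>}" using h(2) lr by auto
  then obtain l' where l': "l' \<in> {\<alpha>..<\<beta>}" "h l' = l" by blast
  have l'_le: "l \<le> h x \<longleftrightarrow> l' \<le> x" if "x \<in> {\<alpha>..<\<beta>}" for x
    using less[OF that l'(1)] l'(2) by auto
  show thesis
  proof (cases "r < 1")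
    case True
    then have "r \<in> h ` {\<alpha>..<\<beta>}" using h(2) lr by auto
    then obtain r' where r': "r' \<in> {\<alpha>..<\<beta>}" "h r' = r" by blast
    have "l' < r'" using less[OF l'(1) r'(1)] l' r' lr by simp
    moreover have "{x \<in> {\<alpha>..<\<beta>}. h x \<in> {l..<r}} = {l'..<r'}"
      using l'_le less[OF _ r'(1)] l'(1) r' by auto
    ultimately show thesis using that[of l' r'] l' r' by auto
  next
    case False
    then have "r = 1" using lr by simp
    then have "{x \<in> {\<alpha>..<\<beta>}. h x \<in> {l..<r}} = {l'..<\<beta>}"
      using l'_le l'(1) h(2) by fastforce
    then show thesis using that[of l' \<beta>] l' by auto
  qed
qed

lemma words_Suc: "w \<in> words g (Suc n) \<longleftrightarrow> (\<exists>k v. w = k # v \<and> k < g \<and> v \<in> words g n)"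
  by (cases w) (auto simp: words_def)

lemma finite_words: "finite (words g n)"
  using finite_lists_length_eq[of "{0..<g}" n] by (simp add: words_def conj_commute)

section \<open>Digits, branches and cylinders of one map\<close>

text \<open>The content of \<open>good_map\<close> with the derivative and the distortion constant
  fixed.\<close>

locale expanding_map =
  fixes g :: nat and a :: "nat \<Rightarrow> real" and f D :: "real \<Rightarrow> real" and K :: real
  assumes g: "2 \<le> g" and a_0: "a 0 = 0" and a_g: "a g = 1"
    and a_less: "k < g \<Longrightarrow> a k < a (Suc k)"
    and mono: "k < g \<Longrightarrow> mono_on (part_int a k) f \<or> antimono_on (part_int a k) f"
    and onto: "k < g \<Longrightarrow> f ` part_int a k = {0..<1}"
    and expand: "k < g \<Longrightarrow> x \<in> part_int a k \<Longrightarrow> y \<in> part_int a k \<Longrightarrow> \<bar>x - y\<bar> \<le> \<bar>f x - f y\<bar>"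
    and diam: "(\<And>i. xs i < g) \<Longrightarrow> (\<lambda>n. diameter (cyl a f (map xs [0..<n]))) \<longlonglongrightarrow> 0"
    and K: "0 < K"
    and deriv: "k < g \<Longrightarrow> x \<in> part_int a k \<Longrightarrow>
        (f has_real_derivative D x) (at x within part_int a k)"
    and distortion: "w \<in> words g n \<Longrightarrow> y \<in> cyl a f w \<Longrightarrow> z \<in> cyl a f w \<Longrightarrow>
        \<bar>\<Prod>j<n. D ((f ^^ j) y)\<bar> / \<bar>\<Prod>j<n. D ((f ^^ j) z)\<bar> < K"
begin

lemma a_strict: "i < j \<Longrightarrow> j \<le> g \<Longrightarrow> a i < a j"
proof (induction j)
  case (Suc j)
  then show ?case using a_less[of j] by (cases "i = j") auto
qed simp

lemma a_mono: "i \<le> j \<Longrightarrow> j \<le> g \<Longrightarrow> a i \<le> a j"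
  using a_strict[of i j] by (cases "i = j") auto

lemma part_int_subset: "k < g \<Longrightarrow> part_int a k \<subseteq> {0..<1}"
  using a_mono[of 0 k] a_mono[of "Suc k" g] a_0 a_g by (auto simp: part_int_def)

lemma ex_part_int:
  assumes "x \<in> {0..<1}"
  shows "\<exists>k<g. x \<in> part_int a k"
proof -
  have "n \<le> g \<Longrightarrow> x < a n \<Longrightarrow> \<exists>k<n. x \<in> part_int a k" for n
  proof (induction n)
    case 0
    then show ?case using assms a_0 by simp
  next
    case (Suc n)
    then show ?case
      by (cases "x < a n") (auto simp: part_int_def not_less less_Suc_eq)
  qed
  from this[of g] show ?thesis using assms a_g by auto
qed

lemma part_int_unique:
  assumes "k < g" "k' < g" "x \<in> part_int a k" "x \<in> part_int a k'"
  shows "k = k'"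
  using assms a_mono[of "Suc k" k'] a_mono[of "Suc k'" k]
  by (cases k k' rule: linorder_cases) (auto simp: part_int_def)

lemma f_range: "x \<in> {0..<1} \<Longrightarrow> f x \<in> {0..<1}"
  using ex_part_int onto by blast

lemma funpow_range: "x \<in> {0..<1} \<Longrightarrow> (f ^^ i) x \<in> {0..<1}"
  by (induction i) (use f_range in auto)

lemma code_eqI: "k < g \<Longrightarrow> (f ^^ i) x \<in> part_int a k \<Longrightarrow> code g a f x i = k"
  unfolding code_def using part_int_unique by blast

lemma code_mem:
  assumes "x \<in> {0..<1}"
  shows "code g a f x i < g \<and> (f ^^ i) x \<in> part_int a (code g a f x i)"
  using ex_part_int[OF funpow_range[OF assms, of i]] code_eqI by metis

lemma mem_cyl_iff:
  assumes "w \<in> words g n"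
  shows "x \<in> cyl a f w \<longleftrightarrow> x \<in> {0..<1} \<and> (\<forall>i<n. code g a f x i = w ! i)"
proof -
  have len: "length w = n" using assms by (simp add: words_def)
  have wg: "w ! i < g" if "i < n" for i
    using assms that nth_mem[of i w] unfolding words_def by fastforce
  have "(f ^^ i) x \<in> part_int a (w ! i) \<longleftrightarrow> code g a f x i = w ! i"
    if "x \<in> {0..<1}" "i < n" for i
    using code_mem[OF that(1), of i] code_eqI[OF wg[OF that(2)]] by metis
  then show ?thesis
    unfolding cyl_def len by blast
qed

lemma code_shift: "code g a f ((f ^^ n) x) i = code g a f x (n + i)"
  unfolding code_def by (simp add: funpow_add add.commute)

text \<open>A decreasing branch onto \<open>{0..<1}\<close> is impossible: it would attain a maximum at the
  left endpoint.\<close>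
lemma branch_strict_mono:
  assumes k: "k < g"
  shows "strict_mono_on (part_int a k) f"
proof -
  have "mono_on (part_int a k) f"
  proof (rule ccontr)
    assume "\<not> ?thesis"
    with mono[OF k] have anti: "antimono_on (part_int a k) f" by blast
    have ak: "a k \<in> part_int a k" using a_less[OF k] by (simp add: part_int_def)
    then have "f (a k) \<in> {0..<1}" using onto[OF k] by blast
    then have "(f (a k) + 1) / 2 \<in> f ` part_int a k" using onto[OF k] by auto
    then obtain x where x: "x \<in> part_int a k" "(f (a k) + 1) / 2 = f x" by (rule imageE)
    then have "a k \<le> x" by (simp add: part_int_def)
    then have "f x \<le> f (a k)"
      using monotone_onD[OF anti ak x(1)] by simp
    with x(2) \<open>f (a k) \<in> {0..<1}\<close> show False by auto
  qed
  moreover have "inj_on f (part_int a k)"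
    using expand[OF k] by (fastforce intro: inj_onI)
  ultimately show ?thesis
    by (auto simp: strict_mono_on_def mono_on_def inj_on_def less_le)
qed

lemma cyl_Nil: "cyl a f [] = {0..<1}"
  by (auto simp: cyl_def)

lemma cyl_Cons:
  assumes "k < g"
  shows "cyl a f (k # w) = {x \<in> part_int a k. f x \<in> cyl a f w}"
proof -
  have "(\<forall>i<length (k # w). (f ^^ i) x \<in> part_int a ((k # w) ! i)) \<longleftrightarrow>
      x \<in> part_int a k \<and> (\<forall>i<length w. (f ^^ i) (f x) \<in> part_int a (w ! i))" for x
    by (simp add: All_less_Suc2 funpow_swap1)
  then show ?thesis
    using part_int_subset[OF assms] f_range unfolding cyl_def by blast
qed

text \<open>Induction by peeling off the first digit: the cylinder of \<open>k # v\<close> is the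
  preimage of that of \<open>v\<close> under the increasing branch \<open>k\<close>, and
  \<open>f\<close> maps it onto the latter. So the half-open shape, monotonicity, surjectivity and
  the chain rule all carry over.\<close>

lemma cyl_branch:
  assumes "w \<in> words g n"
  shows "(\<exists>l r. 0 \<le> l \<and> l < r \<and> r \<le> 1 \<and> cyl a f w = {l..<r}) \<and>
    strict_mono_on (cyl a f w) (f ^^ n) \<and> (f ^^ n) ` cyl a f w = {0..<1} \<and>
    (\<forall>x \<in> cyl a f w. ((f ^^ n) has_real_derivative (\<Prod>j<n. D ((f ^^ j) x))) (at x within cyl a f w))"
  using assms
proof (induction n arbitrary: w)
  case 0
  then have "w = []" by (simp add: words_def)
  have "\<exists>l r. 0 \<le> l \<and> l < r \<and> r \<le> 1 \<and> cyl a f w = {l..<r::real}"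
    using \<open>w = []\<close> by (intro exI[of _ 0] exI[of _ 1]) (simp add: cyl_Nil)
  then show ?case
    using \<open>w = []\<close> by (simp add: cyl_Nil strict_mono_on_def id_def)
next
  case (Suc n)
  then obtain k v where w: "w = k # v" "k < g" "v \<in> words g n" by (auto simp: words_Suc)
  note IH = Suc.IH[OF w(3)]
  have C: "cyl a f w = {x \<in> part_int a k. f x \<in> cyl a f v}"
    by (simp add: w cyl_Cons)
  note branch = branch_strict_mono[OF w(2)]
  obtain l r where lr: "0 \<le> l" "l < r" "r \<le> 1" "cyl a f v = {l..<r}" using IH by blast
  obtain l' r' where l'r': "a k \<le> l'" "l' < r'" "r' \<le> a (Suc k)" "cyl a f w = {l'..<r'}"
    using strict_mono_on_vimage_Ico[of "a k" "a (Suc k)" f l r] branch onto[OF w(2)] lr C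
    by (metis part_int_def)
  have "0 \<le> a k" "a (Suc k) \<le> 1"
    using w(2) a_mono[of 0 k] a_mono[of "Suc k" g] a_0 a_g by auto
  with l'r' have 1: "\<exists>l r. 0 \<le> l \<and> l < r \<and> r \<le> 1 \<and> cyl a f w = {l..<r}"
    by (intro exI[of _ l'] exI[of _ r']) auto
  have pow: "f ^^ Suc n = (f ^^ n) \<circ> f" by (rule funpow_Suc_right)
  have 2: "strict_mono_on (cyl a f w) (f ^^ Suc n)"
    using IH branch unfolding pow C strict_mono_on_def by auto
  have img: "f ` cyl a f w = cyl a f v"
  proof -
    have "cyl a f v \<subseteq> f ` part_int a k" using onto[OF w(2)] by (auto simp: cyl_def)
    then show ?thesis unfolding C by auto
  qed
  have 3: "(f ^^ Suc n) ` cyl a f w = {0..<1}"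
    unfolding pow image_comp[symmetric] img using IH by blast
  have 4: "((f ^^ Suc n) has_real_derivative (\<Prod>j<Suc n. D ((f ^^ j) x))) (at x within cyl a f w)"
    if x: "x \<in> cyl a f w" for x
  proof -
    have "(f has_real_derivative D x) (at x within cyl a f w)"
      using x deriv[OF w(2)] by (auto simp: C intro: DERIV_subset)
    moreover have "((f ^^ n) has_real_derivative (\<Prod>j<n. D ((f ^^ j) (f x))))
        (at (f x) within f ` cyl a f w)"
    proof -
      have "f x \<in> cyl a f v" using x img by blast
      with IH show ?thesis unfolding img by blast
    qed
    ultimately have "((f ^^ n) \<circ> f has_real_derivative (\<Prod>j<n. D ((f ^^ j) (f x))) * D x)
        (at x within cyl a f w)"
      by (intro DERIV_image_chain)
    moreover have "(\<Prod>j<n. D ((f ^^ j) (f x))) * D x = (\<Prod>j<Suc n. D ((f ^^ j) x))"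
      by (simp add: prod.lessThan_Suc_shift funpow_swap1 mult.commute del: prod.lessThan_Suc)
    ultimately show ?thesis unfolding pow by simp
  qed
  from 1 2 3 4 show ?case by blast
qed

section \<open>Distortion estimates and lengths of cylinders\<close>

text \<open>The derivative is known only within the cylinder, so the mean value theorem is applied
  on a compact subinterval of it.\<close>

lemma cyl_mean_value:
  assumes w: "w \<in> words g n" and C: "cyl a f w = {l..<r}" and yz: "l \<le> y" "y < z" "z < r"
  obtains \<xi> where "\<xi> \<in> cyl a f w" "(f ^^ n) z - (f ^^ n) y = (\<Prod>j<n. D ((f ^^ j) \<xi>)) * (z - y)"
proof -
  have d: "\<forall>x \<in> cyl a f w. ((f ^^ n) has_real_derivative (\<Prod>j<n. D ((f ^^ j) x))) (at x within cyl a f w)"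
    using cyl_branch[OF w] by (elim conjE)
  have sub: "{y..z} \<subseteq> cyl a f w"
    unfolding C
  proof
    fix x assume "x \<in> {y..z}"
    then have "y \<le> x" "x \<le> z" by simp_all
    with yz show "x \<in> {l..<r}" by (simp only: atLeastLessThan_iff) linarith
  qed
  have "\<exists>x\<in>{y<..<z}. (f ^^ n) z - (f ^^ n) y = (*) (\<Prod>j<n. D ((f ^^ j) x)) (z - y)"
  proof (rule mvt_simple[OF yz(2)])
    fix x assume "y \<le> x" "x \<le> z"
    then have "x \<in> cyl a f w" using sub by auto
    then have "((f ^^ n) has_real_derivative (\<Prod>j<n. D ((f ^^ j) x))) (at x within {y..z})"
      by (intro DERIV_subset[OF bspec[OF d] sub])
    then show "((f ^^ n) has_derivative (*) (\<Prod>j<n. D ((f ^^ j) x))) (at x within {y..z})"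
      by (simp only: has_field_derivative_def)
  qed
  then obtain x where x: "x \<in> {y<..<z}"
    "(f ^^ n) z - (f ^^ n) y = (\<Prod>j<n. D ((f ^^ j) x)) * (z - y)" by (elim bexE)
  then have "x \<in> cyl a f w" using sub by auto
  then show thesis using x(2) by (rule that)
qed

text \<open>The slope between \<open>y\<close> and \<open>z\<close> is the derivative at some
  \<open>\<xi>\<close>, the slope between \<open>l\<close> and \<open>u\<close> that at some
  \<open>\<zeta>\<close>. The latter is at most \<open>1 / (u - l)\<close> because values stay in
  the unit interval, and distortion bounds the former by \<open>K\<close> times the latter.\<close>

lemma funpow_lipschitz:
  assumes w: "w \<in> words g n" and C: "cyl a f w = {l..<r}" and lr: "l < r"
    and yz: "l \<le> y" "y \<le> z" "z < r"
  shows "((f ^^ n) z - (f ^^ n) y) * (r - l) \<le> K * (z - y)"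
proof (cases "y = z")
  case False
  then have less: "y < z" using yz by simp
  have F: "strict_mono_on (cyl a f w) (f ^^ n)" "(f ^^ n) ` cyl a f w = {0..<1}"
    using cyl_branch[OF w] by auto
  define c where "c = (f ^^ n) z - (f ^^ n) y"
  have c: "0 < c"
    using strict_mono_onD[OF F(1) _ _ less] yz C by (simp add: c_def)
  obtain \<xi> where \<xi>: "\<xi> \<in> cyl a f w" "c = (\<Prod>j<n. D ((f ^^ j) \<xi>)) * (z - y)"
    using cyl_mean_value[OF w C yz(1) less yz(3)] unfolding c_def by blast
  \<comment> \<open>The point \<open>r\<close> is outside the cylinder, so the bound is shown for
    every \<open>u < r\<close> and passed to the limit.\<close>
  have "r \<le> l + K * (z - y) / c"
  proof (rule dense_le_bounded[OF lr])
    fix u assume u: "l < u" "u < r"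
    obtain \<zeta> where \<zeta>: "\<zeta> \<in> cyl a f w"
      "(f ^^ n) u - (f ^^ n) l = (\<Prod>j<n. D ((f ^^ j) \<zeta>)) * (u - l)"
      using cyl_mean_value[OF w C order_refl u] by blast
    have "(f ^^ n) l < (f ^^ n) u"
      using strict_mono_onD[OF F(1) _ _ u(1)] u lr C by simp
    \<comment> \<open>Distortion is stated as a quotient, which is 0 for a zero denominator; strict
      growth from \<open>l\<close> to \<open>u\<close> excludes this case.\<close>
    then have pos: "0 < (\<Prod>j<n. D ((f ^^ j) \<zeta>))"
      using \<zeta>(2) u by (metis diff_gt_0_iff_gt zero_less_mult_pos2)
    then have "(\<Prod>j<n. D ((f ^^ j) \<xi>)) \<le> K * (\<Prod>j<n. D ((f ^^ j) \<zeta>))"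
      using distortion[OF w \<xi>(1) \<zeta>(1)] by (simp add: field_simps)
    then have "(\<Prod>j<n. D ((f ^^ j) \<xi>)) * ((z - y) * (u - l))
        \<le> K * (\<Prod>j<n. D ((f ^^ j) \<zeta>)) * ((z - y) * (u - l))"
      using less u by (intro mult_right_mono) auto
    then have "c * (u - l) \<le> K * (z - y) * ((f ^^ n) u - (f ^^ n) l)"
      unfolding \<xi>(2) \<zeta>(2) by (simp add: algebra_simps)
    also have "\<dots> \<le> K * (z - y) * 1"
    proof (intro mult_left_mono)
      have "(f ^^ n) u \<in> {0..<1}" "(f ^^ n) l \<in> {0..<1}" using F(2) C u lr by auto
      then show "(f ^^ n) u - (f ^^ n) l \<le> 1" by auto
    qed (use K less in auto)
    finally show "u \<le> l + K * (z - y) / c"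
      using c by (simp add: field_simps)
  qed
  then show ?thesis using c by (simp add: c_def[symmetric] field_simps)
qed simp

definition gap :: real where "gap = Min ((\<lambda>k. a (Suc k) - a k) ` {..<g})"

lemma gap_pos: "0 < gap"
  unfolding gap_def using g a_less by (subst Min_gr_iff) (auto simp: lessThan_empty_iff)

lemma gap_le: "k < g \<Longrightarrow> gap \<le> a (Suc k) - a k"
  unfolding gap_def by (rule Min_le) auto

text \<open>\<open>f ^^ n\<close> maps the child onto a partition interval of length at least
  \<open>gap\<close> while stretching by at most \<open>K / (r - l)\<close>. The right endpoint
  \<open>a (Suc k)\<close> is again approached from below.\<close>

lemma cyl_child_ratio:
  assumes w: "w \<in> words g n" and C: "cyl a f w = {l..<r}" and lr: "l < r"
    and k: "k < g" and C': "cyl a f (w @ [k]) = {l'..<r'}" and l'r': "l' < r'"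
  shows "gap / K * (r - l) \<le> r' - l'"
proof -
  have len: "length w = n" using w by (simp add: words_def)
  have C'_eq: "cyl a f (w @ [k]) = {x \<in> cyl a f w. (f ^^ n) x \<in> part_int a k}"
    using len by (auto simp: cyl_def All_less_Suc nth_append less_Suc_eq)
  have img: "part_int a k \<subseteq> (f ^^ n) ` cyl a f (w @ [k])"
    using cyl_branch[OF w] part_int_subset[OF k] unfolding C'_eq by auto
  have F: "strict_mono_on (cyl a f w) (f ^^ n)"
    using cyl_branch[OF w] by auto
  have "a (Suc k) \<le> a k + K * (r' - l') / (r - l)"
  proof (rule dense_le_bounded[OF a_less[OF k]])
    fix u assume u: "a k < u" "u < a (Suc k)"
    then have "a k \<in> part_int a k" "u \<in> part_int a k" by (auto simp: part_int_def)
    then have "a k \<in> (f ^^ n) ` {l'..<r'}" "u \<in> (f ^^ n) ` {l'..<r'}"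
      using img unfolding C' by blast+
    then obtain y z where yz: "y \<in> {l'..<r'}" "(f ^^ n) y = a k" "z \<in> {l'..<r'}" "(f ^^ n) z = u"
      by (elim imageE) (metis (no_types))
    have "{l'..<r'} \<subseteq> cyl a f w" using C'_eq unfolding C' by blast
    then have yzC: "y \<in> cyl a f w" "z \<in> cyl a f w" using yz by blast+
    have "y < z"
      using strict_mono_on_less[OF F yzC] yz u by simp
    then have "(u - a k) * (r - l) \<le> K * (z - y)"
      using funpow_lipschitz[OF w C lr, of y z] yz yzC C by auto
    also have "\<dots> \<le> K * (r' - l')" using yz K by (intro mult_left_mono) auto
    finally show "u \<le> a k + K * (r' - l') / (r - l)"
      using lr by (simp add: field_simps)
  qed
  then have "(a (Suc k) - a k) * (r - l) \<le> K * (r' - l')"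
    using lr by (simp add: field_simps)
  moreover have "gap * (r - l) \<le> (a (Suc k) - a k) * (r - l)"
    using gap_le[OF k] lr by (intro mult_right_mono) auto
  ultimately show ?thesis using K by (simp add: field_simps)
qed

lemma diameter_Ico: "l < r \<Longrightarrow> diameter {l..<r} = r - (l::real)"
  using diameter_closure[of "{l..<r}"] by simp

text \<open>Among the cylinders around the midpoint, take the first that lies inside the interval.
  Its parent does not, so the parent has at least half the length of the interval, and
  \<open>cyl_child_ratio\<close> bounds the child from below.\<close>

lemma interval_contains_cyl:
  assumes xy: "0 \<le> x" "x < y" "y \<le> 1"
  obtains n w l r where "w \<in> words g n" "cyl a f w = {l..<r}" "l < r" "{l..<r} \<subseteq> {x..<y}"
    "min 1 (gap / (2 * K)) * (y - x) \<le> r - l"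
proof -
  define z where "z = (x + y) / 2"
  have z: "z \<in> {0..<1}" using xy by (auto simp: z_def)
  define W where "W n = map (code g a f z) [0..<n]" for n
  have W: "W n \<in> words g n" for n
    using code_mem[OF z] by (auto simp: W_def words_def)
  have zW: "z \<in> cyl a f (W n)" for n
    using z by (subst mem_cyl_iff[OF W]) (auto simp: W_def)
  obtain l r where lr: "\<And>n. cyl a f (W n) = {l n..<r n}" "\<And>n. l n < r n"
  proof -
    have "\<forall>n. \<exists>l r. cyl a f (W n) = {l..<r} \<and> l < r"
      using cyl_branch[OF W] by blast
    then obtain l r where "\<forall>n. cyl a f (W n) = {l n..<r n} \<and> l n < r n"
      by metis
    then show thesis by (intro that) auto
  qed
  have "(\<lambda>n. diameter (cyl a f (W n))) \<longlonglongrightarrow> 0"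
    unfolding W_def using code_mem[OF z] by (intro diam) blast
  then have "(\<lambda>n. r n - l n) \<longlonglongrightarrow> 0"
    by (simp add: lr diameter_Ico)
  then have "eventually (\<lambda>n. r n - l n < (y - x) / 2) sequentially"
    using xy by (intro order_tendstoD) auto
  then obtain n0 where "r n0 - l n0 < (y - x) / 2"
    by (auto simp: eventually_sequentially)
  define P where "P n \<longleftrightarrow> {l n..<r n} \<subseteq> {x..<y}" for n
  have zlr: "l n \<le> z" "z < r n" for n using zW[of n] lr by auto
  \<comment> \<open>A cylinder around the midpoint that is shorter than half the interval cannot
    reach past either end.\<close>
  have small: "P n" if "r n - l n < (y - x) / 2" for n
    using that zlr[of n] unfolding P_def z_def by (intro subsetI) (auto simp: field_simps)
  have "P n0" by (rule small) fact
  then have P: "P (LEAST n. P n)" by (rule LeastI)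
  show thesis
  proof (rule that[OF W lr(1) lr(2)])
    show "{l (LEAST n. P n)..<r (LEAST n. P n)} \<subseteq> {x..<y}" using P by (simp add: P_def)
    show "min 1 (gap / (2 * K)) * (y - x) \<le> r (LEAST n. P n) - l (LEAST n. P n)"
    proof (cases "LEAST n. P n")
      \<comment> \<open>There is no parent for the whole unit interval; the \<open>1\<close> in the
        minimum covers this case.\<close>
      case 0
      have "{l 0..<r 0} = {0..<1}" using lr(1)[of 0] by (simp add: W_def cyl_Nil)
      then have "r 0 - l 0 = 1" using lr(2)[of 0] by (simp add: atLeastLessThan_eq_iff)
      moreover have "min 1 (gap / (2 * K)) * (y - x) \<le> 1 * 1"
        using xy gap_pos K by (intro mult_mono) auto
      ultimately show ?thesis using 0 by simp
    next
      case (Suc n)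
      then have "\<not> P n" using not_less_Least[of n P] by simp
      then have big: "(y - x) / 2 \<le> r n - l n" using small by force
      have WS: "W (Suc n) = W n @ [code g a f z n]" by (simp add: W_def)
      have "min 1 (gap / (2 * K)) * (y - x) \<le> gap / (2 * K) * (y - x)"
        using xy by (intro mult_right_mono) auto
      also have "\<dots> = gap / K * ((y - x) / 2)" by simp
      also have "\<dots> \<le> gap / K * (r n - l n)"
        using big gap_pos K by (intro mult_left_mono) auto
      also have "\<dots> \<le> r (Suc n) - l (Suc n)"
        using cyl_child_ratio[OF W lr(1) lr(2), of "code g a f z n" n "l (Suc n)" "r (Suc n)"]
          code_mem[OF z] lr[of "Suc n"] WS by simp
      finally show ?thesis using Suc by simp
    qed
  qed
qed

end

lemma good_map_expanding:
  assumes "good_map g a f"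
  obtains D K where "expanding_map g a f D K"
proof -
  obtain D K where "K > 0 \<and>
        (\<forall>k < g. \<forall>x \<in> part_int a k.
            (f has_real_derivative D x) (at x within part_int a k)) \<and>
        (\<forall>w n. w \<in> words g n \<longrightarrow> (\<forall>y \<in> cyl a f w. \<forall>z \<in> cyl a f w.
            \<bar>\<Prod>j<n. D ((f ^^ j) y)\<bar> / \<bar>\<Prod>j<n. D ((f ^^ j) z)\<bar> < K))"
    using assms unfolding good_map_def by blast
  with assms have "expanding_map g a f D K"
    unfolding good_map_def expanding_map_def by simp
  then show thesis by (rule that)
qed

section \<open>Hausdorff content of countable intersections\<close>

lemma hausdorff_pre_le:
  assumes "A \<subseteq> (\<Union>j. U j)" "\<And>j. bounded (U j)" "\<And>j. diameter (U j) \<le> \<delta>"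
  shows "hausdorff_pre s \<delta> A \<le> (\<Sum>j. ennreal (diameter (U j) powr s))"
  unfolding hausdorff_pre_def using assms by (intro INF_lower) auto

lemma hausdorff_measure_eq_0I:
  assumes "\<And>\<delta> e. 0 < \<delta> \<Longrightarrow> 0 < e \<Longrightarrow> hausdorff_pre s \<delta> A \<le> ennreal e"
  shows "hausdorff_measure s A = 0"
proof -
  have "hausdorff_pre s \<delta> A \<le> 0" if "0 < \<delta>" for \<delta>
    by (rule ennreal_le_epsilon) (use assms[OF that] in simp)
  then show ?thesis
    unfolding hausdorff_measure_def by (simp add: SUP_eq_const le_zero_eq)
qed

text \<open>The \<open>2 ^ n\<close> dyadic intervals of level \<open>n\<close> cost
  \<open>(2 powr (1 - s)) ^ n\<close>, which tends to 0. This makes the set of exponents in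
  \<open>hausdorff_dim\<close> nonempty, so that its \<open>Inf\<close> is meaningful.\<close>

lemma hausdorff_measure_null:
  assumes A: "A \<subseteq> {0..<1}" and s: "1 < s"
  shows "hausdorff_measure s A = 0"
proof (rule hausdorff_measure_eq_0I)
  fix \<delta> e :: real assume \<delta>: "0 < \<delta>" and e: "0 < e"
  have q: "2 powr (1 - s) < (1::real)" using powr_less_mono[of "1 - s" 0 2] s by simp
  obtain n1 where n1: "(1/2) ^ n1 < \<delta>" using real_arch_pow_inv[OF \<delta>, of "1/2"] by auto
  obtain n2 where n2: "(2 powr (1 - s)) ^ n2 < e" using real_arch_pow_inv[OF e q] by auto
  define n where "n = max n1 n2"
  have "(1/2::real) ^ n \<le> (1/2) ^ n1" unfolding n_def by (rule power_decreasing) auto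
  with n1 have n\<delta>: "(1/2) ^ n < \<delta>" by linarith
  have "(2 powr (1 - s)) ^ n \<le> (2 powr (1 - s)) ^ n2"
    unfolding n_def using q by (intro power_decreasing) auto
  with n2 have ne: "(2 powr (1 - s)) ^ n < e" by linarith
  \<comment> \<open>Padding by empty sets is free, as \<open>0 powr s = 0\<close>.\<close>
  define U where "U j = (if j < 2 ^ n then dyadic (n, j) else {})" for j
  have dU: "diameter (U j) \<le> (1/2) ^ n" for j
    using diameter_dyadic[of "(n, j)"] by (simp add: U_def)
  have bU: "bounded (U j)" for j by (simp add: U_def bounded_dyadic)
  have cov: "A \<subseteq> (\<Union>j. U j)"
  proof
    fix x assume "x \<in> A"
    then have x: "0 \<le> x" "x < 1" using A by auto
    then obtain v where v: "fst v = n" "x \<in> dyadic v" using ex_dyadic by blast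
    then have "real (snd v) \<le> x * 2 ^ n" by (simp add: dyadic_def field_simps)
    also have "\<dots> < 2 ^ n" using x by simp
    finally have "real (snd v) < real (2 ^ n)" by simp
    then have "snd v < 2 ^ n" by (simp only: of_nat_less_iff)
    with v show "x \<in> (\<Union>j. U j)" by (auto simp: U_def intro!: exI[of _ "snd v"])
  qed
  have "diameter (U j) \<le> \<delta>" for j using dU[of j] n\<delta> by linarith
  with cov bU have "hausdorff_pre s \<delta> A \<le> (\<Sum>j. ennreal (diameter (U j) powr s))"
    by (rule hausdorff_pre_le)
  also have "\<dots> = (\<Sum>j<(2::nat) ^ n. ennreal (diameter (U j) powr s))"
    by (rule suminf_finite) (auto simp: U_def)
  also have "\<dots> \<le> (\<Sum>j<(2::nat) ^ n. ennreal (((1/2) ^ n) powr s))"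
    using dU s by (intro sum_mono ennreal_leI powr_mono2) (auto intro!: diameter_ge_0 simp: bU)
  also have "\<dots> = ennreal (2 ^ n * ((1/2) ^ n) powr s)"
    by (simp add: ennreal_mult flip: ennreal_numeral ennreal_power)
  also have "2 ^ n * ((1/2) ^ n) powr s = (2 powr (1 - s)) ^ n"
    by (simp add: powr_diff powr_divide power_divide powr_power field_simps
        flip: powr_realpow) (simp add: powr_powr mult.commute)
  also have "ennreal \<dots> \<le> ennreal e" using ne by (intro ennreal_leI) simp
  finally show "hausdorff_pre s \<delta> A \<le> ennreal e" .
qed

lemma hausdorff_dim_le:
  "0 \<le> s \<Longrightarrow> hausdorff_measure s A = 0 \<Longrightarrow> hausdorff_dim A \<le> s"
  unfolding hausdorff_dim_def by (rule cInf_lower) (auto intro: bdd_belowI[of _ 0])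

lemma hausdorff_dim_geI:
  assumes "A \<subseteq> {0..<1}" "\<And>s. 0 \<le> s \<Longrightarrow> hausdorff_measure s A = 0 \<Longrightarrow> d \<le> s"
  shows "d \<le> hausdorff_dim A"
proof -
  have "2 \<in> {s. 0 \<le> s \<and> hausdorff_measure s A = 0}"
    using hausdorff_measure_null[OF assms(1)] by simp
  then show ?thesis
    unfolding hausdorff_dim_def using assms(2) by (intro cInf_greatest) blast+
qed

lemma hausdorff_dim_le_1: "A \<subseteq> {0..<1} \<Longrightarrow> hausdorff_dim A \<le> 1"
  by (rule dense_ge) (use hausdorff_dim_le hausdorff_measure_null in auto)

lemma hausdorff_pre_mono: "A \<subseteq> B \<Longrightarrow> hausdorff_pre s \<delta> A \<le> hausdorff_pre s \<delta> B"
  unfolding hausdorff_pre_def by (rule INF_superset_mono) auto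

lemma hausdorff_measure_mono: "A \<subseteq> B \<Longrightarrow> hausdorff_measure s A \<le> hausdorff_measure s B"
  unfolding hausdorff_measure_def by (rule SUP_mono) (use hausdorff_pre_mono in blast)

lemma hausdorff_dim_mono:
  assumes "A \<subseteq> B" "B \<subseteq> {0..<1}"
  shows "hausdorff_dim A \<le> hausdorff_dim B"
proof (rule hausdorff_dim_geI[OF assms(2)])
  fix s :: real assume "0 \<le> s" "hausdorff_measure s B = 0"
  then show "hausdorff_dim A \<le> s"
    using hausdorff_measure_mono[OF assms(1), of s] by (intro hausdorff_dim_le) auto
qed

section \<open>Lower bounds for Hausdorff content\<close>

text \<open>Diameters are unrestricted, so such bounds can be transported by expanding maps;
  boundedness keeps \<open>diameter\<close> meaningful.\<close>

definition content_ge :: "real \<Rightarrow> real \<Rightarrow> real set \<Rightarrow> bool" where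
  "content_ge s c A \<longleftrightarrow> (\<forall>U :: nat \<Rightarrow> real set. (\<forall>j. bounded (U j)) \<longrightarrow> A \<subseteq> (\<Union>j. U j) \<longrightarrow>
      ennreal c \<le> (\<Sum>j. ennreal (diameter (U j) powr s)))"

lemma content_geD:
  "content_ge s c A \<Longrightarrow> (\<And>j. bounded (U j)) \<Longrightarrow> A \<subseteq> (\<Union>j. U j) \<Longrightarrow>
     ennreal c \<le> (\<Sum>j. ennreal (diameter (U j) powr s))"
  by (simp add: content_ge_def)

lemma term_le_suminf: "f j \<le> (\<Sum>i. f i :: ennreal)"
  using sum_le_suminf[of f "{j}"] by simp

text \<open>A cover with a small sum consists of small sets, so positive Hausdorff measure forces
  positive content.\<close>
lemma content_ge_of_dim:
  assumes s: "0 < s" and dim: "s < hausdorff_dim E"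
  shows "\<exists>c>0. content_ge s c E"
proof (rule ccontr)
  assume none: "\<not> ?thesis"
  have "hausdorff_measure s E = 0"
  proof (rule hausdorff_measure_eq_0I)
    fix \<delta> e :: real assume "0 < \<delta>" "0 < e"
    \<comment> \<open>A sum below \<open>c\<close> is below \<open>e\<close>, and each of its terms
      is below \<open>\<delta> powr s\<close>, which forces the diameters below
      \<open>\<delta>\<close>.\<close>
    define c where "c = min e (\<delta> powr s)"
    have c: "0 < c" using \<open>0 < \<delta>\<close> \<open>0 < e\<close> by (simp add: c_def)
    with none have "\<not> content_ge s c E" by blast
    then obtain U where U: "\<And>j. bounded (U j)" "E \<subseteq> (\<Union>j. U j)"
      "(\<Sum>j. ennreal (diameter (U j) powr s)) < ennreal c"
      by (auto simp: content_ge_def not_le)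
    have "diameter (U j) \<le> \<delta>" for j
    proof -
      have "ennreal (diameter (U j) powr s) < ennreal c"
        using U(3) term_le_suminf[of "\<lambda>j. ennreal (diameter (U j) powr s)" j] by (rule le_less_trans[rotated])
      then have "diameter (U j) powr s < \<delta> powr s"
        by (simp add: c_def ennreal_less_iff)
      then show ?thesis
        using powr_mono2[of s \<delta> "diameter (U j)"] s \<open>0 < \<delta>\<close> by force
    qed
    then have "hausdorff_pre s \<delta> E \<le> (\<Sum>j. ennreal (diameter (U j) powr s))"
      using U by (intro hausdorff_pre_le)
    also have "\<dots> \<le> ennreal e"
      using U(3) by (rule less_imp_le[THEN order_trans]) (simp add: c_def ennreal_leI)
    finally show "hausdorff_pre s \<delta> E \<le> ennreal e" .
  qed
  then have "hausdorff_dim E \<le> s" using s by (intro hausdorff_dim_le) auto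
  with dim show False by simp
qed

lemma content_ge_diff_countable:
  assumes E: "content_ge s c E" and Q: "countable Q"
  shows "content_ge s c (E - Q)"
  unfolding content_ge_def
proof (intro allI impI)
  fix U :: "nat \<Rightarrow> real set"
  assume U: "\<forall>j. bounded (U j)" "E - Q \<subseteq> (\<Union>j. U j)"
  \<comment> \<open>Even indices carry the given cover, odd ones singletons enumerating
    \<open>Q\<close>, which have diameter 0 and cost \<open>0 powr s = 0\<close>.\<close>
  define U' where "U' j = (if even j then U (j div 2) else {from_nat_into Q (j div 2)})" for j
  have "E \<subseteq> (\<Union>j. U' j)"
  proof
    fix x assume x: "x \<in> E"
    show "x \<in> (\<Union>j. U' j)"
    proof (cases "x \<in> Q")
      case True
      then obtain i where "from_nat_into Q i = x" using from_nat_into_surj[OF Q] by blast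
      then have "x \<in> U' (Suc (2 * i))" by (simp add: U'_def)
      then show ?thesis by blast
    next
      case False
      then obtain i where "x \<in> U i" using U x by blast
      then have "x \<in> U' (2 * i)" by (simp add: U'_def)
      then show ?thesis by blast
    qed
  qed
  moreover have "bounded (U' j)" for j using U by (simp add: U'_def)
  ultimately have "ennreal c \<le> (\<Sum>j. ennreal (diameter (U' j) powr s))"
    by (intro content_geD[OF E])
  also have "\<dots> = (\<Sum>j. ennreal (diameter (U' (2 * j)) powr s))"
  proof (rule suminf_mono_reindex[symmetric])
    show "strict_mono (\<lambda>j::nat. 2 * j)" by (simp add: strict_mono_def)
    fix n :: nat assume "n \<notin> range (\<lambda>j. 2 * j)"
    then have "odd n" by (auto elim!: evenE)
    then show "ennreal (diameter (U' n) powr s) = 0" by (simp add: U'_def)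
  qed
  also have "\<dots> = (\<Sum>j. ennreal (diameter (U j) powr s))" by (simp add: U'_def)
  finally show "ennreal c \<le> (\<Sum>j. ennreal (diameter (U j) powr s))" .
qed

lemma net_ge_of_content:
  assumes A: "content_ge s c A" and s: "0 \<le> s"
  shows "ennreal c \<le> net s A"
proof (rule net_geI)
  fix U assume U: "A \<subseteq> \<Union>(dyadic ` U)"
  define C where "C j = (if prod_decode j \<in> U then dyadic (prod_decode j) else {})" for j
  have "A \<subseteq> (\<Union>j. C j)"
  proof
    fix x assume "x \<in> A"
    with U obtain u where "u \<in> U" "x \<in> dyadic u" by blast
    then have "x \<in> C (prod_encode u)" by (simp add: C_def)
    then show "x \<in> (\<Union>j. C j)" by blast
  qed
  moreover have "bounded (C j)" for j by (simp add: C_def bounded_dyadic)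
  ultimately have "ennreal c \<le> (\<Sum>j. ennreal (diameter (C j) powr s))"
    by (intro content_geD[OF A])
  also have "\<dots> \<le> (\<Sum>j. emeasure (nodem s) (U \<inter> {prod_decode j}))"
  proof (intro suminf_le)
    fix j
    show "ennreal (diameter (C j) powr s) \<le> emeasure (nodem s) (U \<inter> {prod_decode j})"
    proof (cases "prod_decode j \<in> U")
      case True
      then have "U \<inter> {prod_decode j} = {prod_decode j}" by blast
      then show ?thesis
        using True s diameter_dyadic[of "prod_decode j"] diameter_ge_0[OF bounded_dyadic, of "prod_decode j"]
        by (auto simp: C_def emeasure_nodem_singleton wt_def intro!: ennreal_leI powr_mono2)
    qed (simp add: C_def)
  qed auto
  also have "\<dots> = emeasure (nodem s) (\<Union>j. U \<inter> {prod_decode j})"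
    by (rule suminf_emeasure) (auto simp: disjoint_family_on_def)
  also have "(\<Union>j. U \<inter> {prod_decode j}) = U"
    by auto (metis prod_encode_inverse)
  finally show "ennreal c \<le> emeasure (nodem s) U" .
qed

lemma content_ge_mono: "content_ge s c A \<Longrightarrow> A \<subseteq> B \<Longrightarrow> content_ge s c B"
  unfolding content_ge_def by blast

section \<open>Fullness from local content, and intersections of full open sets\<close>

text \<open>Removing \<open>Q\<close> and enlarging to \<open>V\<close> keep the local bounds on the
  content, which are then bounds on the net content; \<open>net_full\<close> improves their constant
  to 1.\<close>

lemma fullI:
  assumes s: "0 < s" "s < 1" and c: "0 < c" and Q: "countable Q" and V: "E - Q \<subseteq> V"
    and E: "\<And>x y. 0 \<le> x \<Longrightarrow> x < y \<Longrightarrow> y \<le> 1 \<Longrightarrow> content_ge s (c * (y - x) powr s) (E \<inter> {x..<y})"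
  shows "full s V"
  unfolding full_def
proof (intro allI impI)
  fix v assume v: "dyadic v \<subseteq> {0..<1}"
  show "wt s v \<le> net s (V \<inter> dyadic v)"
  proof (rule net_full[OF _ s(2) c _ v])
    fix v assume v: "dyadic v \<subseteq> {0..<1}"
    define x y where "x = real (snd v) / 2 ^ fst v" and "y = real (Suc (snd v)) / 2 ^ fst v"
    have vxy: "dyadic v = {x..<y}" by (simp add: dyadic_def x_def y_def)
    have xy: "x < y" "0 \<le> x" "y - x = (1/2) ^ fst v"
      by (simp_all add: x_def y_def field_simps)
    have "y \<le> 1"
    proof (rule ccontr)
      assume "\<not> y \<le> 1"
      then have "max x 1 \<in> dyadic v" using xy vxy by auto
      with v show False by auto
    qed
    then have "content_ge s (c * (y - x) powr s) (E \<inter> dyadic v)"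
      using E[OF xy(2,1)] unfolding vxy by blast
    then have "content_ge s (c * (y - x) powr s) (V \<inter> dyadic v)"
      by (rule content_ge_mono[OF content_ge_diff_countable[OF _ Q]]) (use V in blast)
    then have "ennreal (c * (y - x) powr s) \<le> net s (V \<inter> dyadic v)"
      using s by (intro net_ge_of_content) auto
    then show "ennreal c * wt s v \<le> net s (V \<inter> dyadic v)"
      using c by (simp add: xy wt_def ennreal_mult)
  qed (use s in simp)
qed

lemma subset_open_interval:
  assumes "bounded (U :: real set)" "diameter U < len"
  shows "\<exists>x. U \<subseteq> {x<..<x + len}"
proof (cases "U = {}")
  case False
  have bdd: "bdd_below U" using assms(1) by (rule bounded_imp_bdd_below)
  \<comment> \<open>Half of the slack in length goes to each side of \<open>U\<close>.\<close>
  define e where "e = (len - diameter U) / 2"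
  have "Inf U - e < u \<and> u < Inf U - e + len" if u: "u \<in> U" for u
  proof -
    have "u - diameter U \<le> Inf U"
    proof (rule cInf_greatest[OF False])
      fix v assume "v \<in> U"
      then have "dist u v \<le> diameter U" using diameter_bounded_bound[OF assms(1) u] by blast
      then show "u - diameter U \<le> v" by (simp add: dist_real_def abs_le_iff)
    qed
    moreover have "Inf U \<le> u" using u bdd by (rule cInf_lower)
    moreover have "e > 0" using assms(2) by (simp add: e_def)
    ultimately show ?thesis using assms(2) by (simp add: e_def field_simps)
  qed
  then show ?thesis by (intro exI[of _ "Inf U - e"]) auto
qed simp

text \<open>A cover of cost below \<open>1/16\<close> is enlarged to open intervals at an extra cost
  of at most \<open>1/16\<close>. As \<open>net_cover_le\<close> loses the factor 4 and
  \<open>4 * (1/16 + 1/16) = 1/2\<close>, this contradicts the content above \<open>1/2\<close> of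
  the nested grid sets.\<close>

lemma full_Inter_cover:
  assumes s: "0 < s" "s < 1" and V: "\<And>k::nat. full s (V k)" "\<And>k. open (V k)"
    and U: "\<And>j::nat. bounded (U j)" "\<And>j. diameter (U j) \<le> 1/2" "(\<Inter>k. V k) \<subseteq> (\<Union>j. U j)"
  shows "1/16 \<le> (\<Sum>j. ennreal (diameter (U j) powr s))"
proof (rule ccontr)
  assume small: "\<not> ?thesis"
  define P where "P A \<longleftrightarrow> (\<exists>n. gridset n A) \<and> ennreal (1/2) < net s A" for A
  have start: "P {0..<1}"
  proof -
    have grid: "gridset 0 {0..<1}"
      unfolding gridset_def
    proof (intro conjI allI impI)
      fix v :: "nat \<times> nat" assume "fst v = 0"
      then show "dyadic v \<subseteq> {0..<1} \<or> dyadic v \<inter> {0..<1} = {}"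
        by (cases "snd v = 0") (auto simp: dyadic_def)
    qed simp
    have "wt s (0, 0) \<le> net s {0..<1}"
      using full_dyadic[OF V(1), of "(0, 0)"] by (simp add: dyadic_root)
    moreover have "ennreal (1/2) < ennreal 1" by (subst ennreal_less_iff) auto
    ultimately have "ennreal (1/2) < net s {0..<1}" by (simp add: wt_def)
    with grid show ?thesis by (auto simp: P_def)
  qed
  have step: "\<exists>A'. P A' \<and> A' \<subseteq> A \<and> closure A' \<subseteq> V k" if "P A" for A k
  proof -
    from that obtain n where A: "gridset n A" "ennreal (1/2) < net s A" by (auto simp: P_def)
    obtain n' A' where "gridset n' A'" "A' \<subseteq> A" "closure A' \<subseteq> V k" "ennreal (1/2) < net s A'"
      by (rule net_refine[OF less_imp_le[OF s(1)] V A])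
    then show ?thesis by (auto simp: P_def)
  qed
  \<comment> \<open>Step \<open>k\<close> takes care of \<open>V k\<close>; the strict bound
    \<open>1/2\<close> holds for the unit interval, of content at least 1, and is preserved by
    \<open>net_refine\<close>.\<close>
  have "\<exists>A. \<forall>k. P (A k) \<and> A (Suc k) \<subseteq> A k \<and> closure (A (Suc k)) \<subseteq> V k"
    by (rule dependent_nat_choice) (use start step in blast)+
  then obtain A where A: "\<And>k. P (A k)" "\<And>k. A (Suc k) \<subseteq> A k" "\<And>k. closure (A (Suc k)) \<subseteq> V k"
    by blast
  have A01: "A k \<subseteq> {0..<1}" for k using A(1)[of k] by (auto simp: P_def gridset_def)
  \<comment> \<open>Allowing \<open>(1/2) ^ Suc j / 16\<close> more for the \<open>j\<close>-th set
    makes room for an open interval strictly longer than its diameter. The cap 1 is for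
    \<open>net_cover_le\<close>; diameters at most \<open>1/2\<close> stay strictly below
    it.\<close>
  define len where "len j = min 1 ((diameter (U j) powr s + (1/2) ^ Suc j / 16) powr (1 / s))" for j
  have len: "diameter (U j) < len j" "len j powr s \<le> diameter (U j) powr s + (1/2) ^ Suc j / 16" "len j \<le> 1"
    for j
  proof -
    let ?d = "diameter (U j)" and ?e = "(1/2::real) ^ Suc j / 16"
    have d: "0 \<le> ?d" using U(1) by (rule diameter_ge_0)
    have "?d = (?d powr s) powr (1/s)" using s d by (simp add: powr_powr)
    also have "\<dots> < (?d powr s + ?e) powr (1/s)"
      using s by (intro powr_less_mono2) auto
    finally show "?d < len j" using U(2)[of j] by (simp add: len_def)
    have "len j powr s \<le> ((?d powr s + ?e) powr (1/s)) powr s"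
      using s by (intro powr_mono2) (auto simp: len_def)
    also have "\<dots> = ?d powr s + ?e" using s by (simp add: powr_powr)
    finally show "len j powr s \<le> ?d powr s + ?e" .
    show "len j \<le> 1" by (simp add: len_def)
  qed
  have "\<forall>j. \<exists>x. U j \<subseteq> {x<..<x + len j}"
    using subset_open_interval[OF U(1) len(1)] by blast
  then obtain x where x: "\<And>j. U j \<subseteq> {x j<..<x j + len j}" by metis
  have "\<exists>k. closure (A k) \<subseteq> (\<Union>j. {x j<..<x j + len j})"
  proof (rule compact_family_subset)
    have "bounded (A k)" for k
      using A01[of k] by (intro bounded_subset[OF bounded_closed_interval[of 0 1]]) auto
    then show "compact (closure (A k))" for k by simp
    show "closure (A (Suc k)) \<subseteq> closure (A k)" for k using A(2) by (rule closure_mono)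
    have "(\<Inter>k. closure (A k)) \<subseteq> (\<Inter>k. V k)"
      by (rule INF_greatest) (rule INF_lower2, rule UNIV_I, rule A(3))
    also note U(3)
    also have "(\<Union>j. U j) \<subseteq> (\<Union>j. {x j<..<x j + len j})"
      by (rule UN_mono[OF order_refl x])
    finally show "(\<Inter>k. closure (A k)) \<subseteq> (\<Union>j. {x j<..<x j + len j})" .
  qed auto
  then obtain k where "closure (A k) \<subseteq> (\<Union>j. {x j<..<x j + len j})" by (elim exE)
  then have k: "A k \<subseteq> (\<Union>j. {x j<..<x j + len j})"
    by (rule order_trans[OF closure_subset])
  let ?S = "\<Sum>j. ennreal (diameter (U j) powr s)"
  have "(\<Sum>j. ennreal ((x j + len j - x j) powr s))
      \<le> (\<Sum>j. ennreal (diameter (U j) powr s) + ennreal ((1/2) ^ Suc j / 16))"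
    using len(2) by (intro suminf_le) (auto simp flip: ennreal_plus intro!: ennreal_leI)
  also have "\<dots> = ?S + (\<Sum>j. ennreal ((1/2) ^ Suc j / 16))"
    by (rule suminf_add[symmetric]) auto
  also have "(\<Sum>j. ennreal ((1/2) ^ Suc j / 16)) = ennreal (1/16)"
    using sums_divide[OF power_half_series, of 16] by (intro suminf_ennreal_eq) auto
  also have "?S + ennreal (1/16) \<le> ennreal (1/16) + ennreal (1/16)"
  proof (rule add_right_mono)
    have "(1/16 :: ennreal) = ennreal (1/16)"
      by (simp add: divide_ennreal[symmetric])
    with small show "?S \<le> ennreal (1/16)" by simp
  qed
  finally have sum: "(\<Sum>j. ennreal ((x j + len j - x j) powr s)) \<le> ennreal (1/16) + ennreal (1/16)" .
  have "ennreal (1/2) < net s (A k)" using A(1) by (simp add: P_def)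
  also have "\<dots> \<le> 4 * (\<Sum>j. ennreal ((x j + len j - x j) powr s))"
  proof (rule net_cover_le[OF _ _ k])
    show "A k \<subseteq> {0..}" using A01[of k] by auto
    have "0 < len j" for j using len(1)[of j] diameter_ge_0[OF U(1)[of j]] by linarith
    then show "x j < x j + len j" for j by simp
    show "x j + len j - x j \<le> 1" for j using len(3) by simp
  qed (use s in auto)
  also have "\<dots> \<le> 4 * (ennreal (1/16) + ennreal (1/16))"
    using sum by (rule mult_left_mono) simp
  also have "\<dots> = ennreal 4 * ennreal (1/8)"
    by (subst ennreal_plus[symmetric]) auto
  also have "\<dots> = ennreal (1/2)"
    by (subst ennreal_mult[symmetric]) auto
  finally show False by (rule less_irrefl[THEN notE])
qed

section \<open>Frequency sets\<close>

context expanding_map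
begin

text \<open>A cover of \<open>E\<close> in the interval, restricted to a comparable cylinder and
  pushed forward by \<open>f ^^ n\<close>, covers \<open>E\<close>: every point of \<open>E\<close>
  has a preimage in the cylinder, and \<open>shift\<close> puts this preimage into \<open>E\<close>.
  Diameters grow by at most \<open>K / (r - l)\<close>, where
  \<open>r - l >= \<kappa> * (y - x)\<close>.\<close>

lemma content_ge_interval:
  assumes s: "0 < s" and c: "0 < c" and E: "content_ge s c E" "E \<subseteq> {0..<1}"
    and shift: "\<And>n x. x \<in> {0..<1} \<Longrightarrow> (f ^^ n) x \<in> E \<Longrightarrow> x \<in> E"
  shows "\<exists>c'>0. \<forall>x y. 0 \<le> x \<longrightarrow> x < y \<longrightarrow> y \<le> 1 \<longrightarrow>
           content_ge s (c' * (y - x) powr s) (E \<inter> {x..<y})"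
proof -
  define \<kappa> where "\<kappa> = min 1 (gap / (2 * K))"
  have \<kappa>: "0 < \<kappa>" using gap_pos K by (simp add: \<kappa>_def)
  have "content_ge s (c * (\<kappa> / K) powr s * (y - x) powr s) (E \<inter> {x..<y})"
    if xy: "0 \<le> x" "x < y" "y \<le> 1" for x y
    unfolding content_ge_def
  proof (intro allI impI)
    fix U :: "nat \<Rightarrow> real set"
    assume U: "\<forall>j. bounded (U j)" "E \<inter> {x..<y} \<subseteq> (\<Union>j. U j)"
    obtain n w l r where w: "w \<in> words g n" "cyl a f w = {l..<r}" "l < r" "{l..<r} \<subseteq> {x..<y}"
      "\<kappa> * (y - x) \<le> r - l"
      using interval_contains_cyl[OF xy] unfolding \<kappa>_def by metis
    define U' where "U' j = (f ^^ n) ` (U j \<inter> {l..<r})" for j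
    have img: "(f ^^ n) ` {l..<r} = {0..<1}"
      using cyl_branch[OF w(1)] unfolding w(2) by blast
    have sub: "{l..<r} \<subseteq> {0..<1}"
      unfolding w(2)[symmetric] by (auto simp: cyl_def)
    have lip: "\<bar>(f ^^ n) u - (f ^^ n) v\<bar> \<le> K / (r - l) * \<bar>u - v\<bar>"
      if "u \<in> {l..<r}" "v \<in> {l..<r}" for u v
    proof -
      have *: "(f ^^ n) u - (f ^^ n) v \<le> K / (r - l) * (u - v)"
        if "u \<in> {l..<r}" "v \<in> {l..<r}" "v \<le> u" for u v
        using funpow_lipschitz[OF w(1,2,3), of v u] that w(3) by (simp add: field_simps)
      have **: "(f ^^ n) v \<le> (f ^^ n) u"
        if "u \<in> {l..<r}" "v \<in> {l..<r}" "v \<le> u" for u v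
        using strict_mono_on_leD[of "{l..<r}" "f ^^ n" v u] cyl_branch[OF w(1)] that
        unfolding w(2) by blast
      show ?thesis
      proof (cases "v \<le> u")
        case True
        with *[OF that] **[OF that] show ?thesis by simp
      next
        case False
        then have "u \<le> v" by simp
        with *[OF that(2,1)] **[OF that(2,1)] show ?thesis by (simp add: abs_minus_commute)
      qed
    qed
    have coef: "0 < K / (r - l)" using K w(3) by simp
    have dU': "diameter (U' j) \<le> K / (r - l) * diameter (U j)" for j
    proof (rule diameter_le)
      show "U' j \<noteq> {} \<or> 0 \<le> K / (r - l) * diameter (U j)"
        using coef U(1) diameter_ge_0[of "U j"] by (intro disjI2 mult_nonneg_nonneg) auto
      fix p q assume "p \<in> U' j" "q \<in> U' j"
      then obtain u v where uv: "u \<in> U j" "u \<in> {l..<r}" "p = (f ^^ n) u"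
        "v \<in> U j" "v \<in> {l..<r}" "q = (f ^^ n) v"
        unfolding U'_def by blast
      have "dist u v \<le> diameter (U j)"
        using U(1) uv by (intro diameter_bounded_bound) auto
      then have "K / (r - l) * \<bar>u - v\<bar> \<le> K / (r - l) * diameter (U j)"
        using coef by (intro mult_left_mono) (auto simp: dist_real_def)
      with lip[OF uv(2,5)] show "norm (p - q) \<le> K / (r - l) * diameter (U j)"
        by (simp add: uv)
    qed
    have bU': "bounded (U' j)" for j
    proof (rule bounded_subset[OF bounded_closed_interval[of 0 1]])
      show "U' j \<subseteq> {0..1}" unfolding U'_def using img by fastforce
    qed
    have cov: "E \<subseteq> (\<Union>j. U' j)"
    proof
      fix z assume z: "z \<in> E"
      then have "z \<in> (f ^^ n) ` {l..<r}" using E(2) img by auto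
      then obtain u where u: "u \<in> {l..<r}" "z = (f ^^ n) u" by (elim imageE)
      then have "u \<in> E" using shift[of u n] z sub by auto
      then obtain j where "u \<in> U j" using U(2) u w(4) by blast
      then have "z \<in> U' j" using u unfolding U'_def by blast
      then show "z \<in> (\<Union>j. U' j)" by blast
    qed
    define M where "M = (K / (r - l)) powr s"
    have M: "0 < M" using K w(3) by (simp add: M_def)
    have "ennreal c \<le> (\<Sum>j. ennreal (diameter (U' j) powr s))"
      by (rule content_geD[OF E(1) bU' cov])
    also have "\<dots> \<le> (\<Sum>j. ennreal M * ennreal (diameter (U j) powr s))"
    proof (intro suminf_le)
      fix j
      have "diameter (U' j) powr s \<le> (K / (r - l) * diameter (U j)) powr s"
        using s dU' diameter_ge_0[OF bU'] by (intro powr_mono2) auto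
      also have "\<dots> = M * diameter (U j) powr s" unfolding M_def by (rule powr_mult)
      finally show "ennreal (diameter (U' j) powr s) \<le> ennreal M * ennreal (diameter (U j) powr s)"
        using M by (simp add: ennreal_leI flip: ennreal_mult)
    qed auto
    also have "\<dots> = ennreal M * (\<Sum>j. ennreal (diameter (U j) powr s))"
      by (rule ennreal_suminf_cmult)
    finally have le: "ennreal c \<le> ennreal M * (\<Sum>j. ennreal (diameter (U j) powr s))" .
    have "c * (\<kappa> / K) powr s * (y - x) powr s = c * (\<kappa> * (y - x) / K) powr s"
      by (simp add: powr_mult[symmetric] mult.assoc)
    also have "\<dots> \<le> c * ((r - l) / K) powr s"
      using c s \<kappa> K w(5) xy by (intro mult_left_mono powr_mono2 divide_right_mono) auto
    also have "\<dots> = 1 / M * c"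
      using K w(3) by (simp add: M_def powr_divide)
    finally have "ennreal (c * (\<kappa> / K) powr s * (y - x) powr s) \<le> ennreal (1 / M) * ennreal c"
      using M c by (simp add: ennreal_leI flip: ennreal_mult)
    also have "\<dots> \<le> ennreal (1 / M) * (ennreal M * (\<Sum>j. ennreal (diameter (U j) powr s)))"
      using le by (rule mult_left_mono) simp
    also have "\<dots> = (\<Sum>j. ennreal (diameter (U j) powr s))"
      using M by (simp add: mult.assoc[symmetric] flip: ennreal_mult)
    finally show "ennreal (c * (\<kappa> / K) powr s * (y - x) powr s)
        \<le> (\<Sum>j. ennreal (diameter (U j) powr s))" .
  qed
  moreover have "0 < c * (\<kappa> / K) powr s" using c \<kappa> K by simp
  ultimately show ?thesis by blast
qed

section \<open>Digit counts and invariance under the shift\<close>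

text \<open>A block starting below \<open>n - length w\<close> ends before position
  \<open>n\<close>.\<close>

lemma tau_cong:
  assumes "\<And>i. i < n \<Longrightarrow> code g a f x i = code g a f y i"
  shows "tau g a f w x n = tau g a f w y n"
proof -
  have "map (\<lambda>j. code g a f x (i + j)) [0..<length w] = map (\<lambda>j. code g a f y (i + j)) [0..<length w]"
    if "i < n - length w" for i
    using that assms by auto
  then show ?thesis unfolding tau_def by (metis (mono_tags, lifting) atLeastLessThan_iff)
qed

text \<open>Occurrences in the shifted expansion are those in the original moved by
  \<open>N\<close>; only the \<open>N\<close> first starting positions can contribute more.\<close>

lemma tau_shift:
  assumes "length w \<le> n"
  shows "tau g a f w ((f ^^ N) x) n \<le> tau g a f w x (n + N)"
    and "tau g a f w x (n + N) \<le> tau g a f w ((f ^^ N) x) n + N"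
proof -
  define B where "B = {i \<in> {0..<n - length w}.
       map (\<lambda>j. code g a f x (N + i + j)) [0..<length w] = w}"
  define C where "C = {i \<in> {0..<n + N - length w}.
       map (\<lambda>j. code g a f x (i + j)) [0..<length w] = w}"
  have B: "tau g a f w ((f ^^ N) x) n = card B"
    by (simp add: tau_def B_def code_shift add.assoc)
  have C: "tau g a f w x (n + N) = card C"
    by (simp add: tau_def C_def)
  have fin: "finite B" "finite C" by (simp_all add: B_def C_def)
  have card: "card ((+) N ` B) = card B" by (simp add: card_image)
  have "(+) N ` B \<subseteq> C" using assms by (auto simp: B_def C_def)
  then show "tau g a f w ((f ^^ N) x) n \<le> tau g a f w x (n + N)"
    using card_mono[OF fin(2)] unfolding B C card[symmetric] by blast
  have "C \<subseteq> (+) N ` B \<union> {..<N}"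
  proof
    fix i assume i: "i \<in> C"
    show "i \<in> (+) N ` B \<union> {..<N}"
    proof (cases "i < N")
      case False
      then have "i = N + (i - N)" "i - N \<in> B" using i assms by (auto simp: B_def C_def)
      then show ?thesis by blast
    qed simp
  qed
  then have "card C \<le> card ((+) N ` B \<union> {..<N})"
    using fin by (intro card_mono) auto
  also have "\<dots> \<le> card B + N"
    using card_Un_le[of "(+) N ` B" "{..<N}"] card by simp
  finally show "tau g a f w x (n + N) \<le> tau g a f w ((f ^^ N) x) n + N"
    unfolding B C .
qed

text \<open>Along the times \<open>r k + N\<close> the counts change by at most \<open>N\<close> and
  the denominators by a factor tending to 1, so the limits agree. This is the \<open>shift\<close>
  hypothesis of \<open>content_ge_interval\<close>.\<close>

lemma freq_acc_shift:
  assumes "freq_acc g a f m ((f ^^ N) x) p"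
  shows "freq_acc g a f m x p"
proof -
  obtain r where r: "strict_mono r"
    "\<And>w. w \<in> words g m \<Longrightarrow>
       (\<lambda>k. real (tau g a f w ((f ^^ N) x) (r k)) / real (r k - m)) \<longlonglongrightarrow> p w"
    using assms unfolding freq_acc_def by blast
  have rt: "filterlim r at_top sequentially" using r(1) by (rule filterlim_subseq)
  have large: "eventually (\<lambda>k. m < r k) sequentially"
    using rt eventually_gt_at_top unfolding filterlim_iff by blast
  have lim: "filterlim (\<lambda>k. real (r k + N - m)) at_top sequentially"
  proof (rule filterlim_compose[of real at_top sequentially, OF filterlim_real_sequentially])
    have "filterlim (\<lambda>n. n + N - m) at_top sequentially"
      unfolding filterlim_at_top
    proof
      fix Z :: nat
      show "eventually (\<lambda>n. Z \<le> n + N - m) sequentially"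
        by (rule eventually_sequentiallyI[of "Z + m"]) simp
    qed
    then show "filterlim (\<lambda>k. r k + N - m) at_top sequentially"
      by (rule filterlim_compose[OF _ rt])
  qed
  have ratio: "(\<lambda>k. real (r k - m) / real (r k + N - m)) \<longlonglongrightarrow> 1"
  proof -
    have "(\<lambda>k. 1 - real N / real (r k + N - m)) \<longlonglongrightarrow> 1 - 0"
      by (intro tendsto_intros tendsto_divide_0[OF tendsto_const] filterlim_at_top_imp_at_infinity lim)
    moreover have "eventually (\<lambda>k. 1 - real N / real (r k + N - m)
        = real (r k - m) / real (r k + N - m)) sequentially"
      using large by eventually_elim (simp add: field_simps of_nat_diff)
    ultimately show ?thesis by (simp add: tendsto_cong)
  qed
  have "(\<lambda>k. real (tau g a f w x (r k + N)) / real (r k + N - m)) \<longlonglongrightarrow> p w"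
    if w: "w \<in> words g m" for w
  proof -
    have len: "length w = m" using w by (simp add: words_def)
    define T where "T k = real (tau g a f w x (r k + N))" for k
    define T' where "T' k = real (tau g a f w ((f ^^ N) x) (r k))" for k
    have "(\<lambda>k. (T k - T' k) / real (r k + N - m)) \<longlonglongrightarrow> 0"
    proof (rule Lim_null_comparison)
      show "(\<lambda>k. real N / real (r k + N - m)) \<longlonglongrightarrow> 0"
        by (intro tendsto_divide_0[OF tendsto_const] filterlim_at_top_imp_at_infinity lim)
      show "eventually (\<lambda>k. norm ((T k - T' k) / real (r k + N - m)) \<le> real N / real (r k + N - m))
          sequentially"
        using large
      proof eventually_elim
        case (elim k)
        have "T' k \<le> T k" "T k \<le> T' k + real N"
          using tau_shift[where w = w and n = "r k" and N = N and x = x] elim len unfolding T_def T'_def by linarith+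
        then show ?case by (simp add: divide_right_mono)
      qed
    qed
    then have "(\<lambda>k. T' k / real (r k - m) * (real (r k - m) / real (r k + N - m))
        + (T k - T' k) / real (r k + N - m)) \<longlonglongrightarrow> p w * 1 + 0"
      using r(2)[OF w] ratio unfolding T'_def by (intro tendsto_intros)
    moreover have "eventually (\<lambda>k. T' k / real (r k - m) * (real (r k - m) / real (r k + N - m))
        + (T k - T' k) / real (r k + N - m) = T k / real (r k + N - m)) sequentially"
      using large
    proof eventually_elim
      case (elim k)
      then have "real (r k - m) \<noteq> 0" by simp
      then show ?case by (simp add: diff_divide_distrib del: of_nat_diff)
    qed
    ultimately show ?thesis unfolding T_def by (simp add: tendsto_cong)
  qed
  moreover have "strict_mono (\<lambda>k. r k + N)" using r(1) by (simp add: strict_mono_def)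
  ultimately show ?thesis unfolding freq_acc_def by blast
qed

section \<open>Approximation of frequency sets by open sets\<close>

text \<open>Membership is witnessed by finitely many digits, which makes the set open up to cylinder
  endpoints. Since \<open>n >= k\<close>, times \<open>n <= m\<close>, where the quotient takes the
  default value 0, disappear in the intersection over \<open>k\<close>.\<close>

definition near :: "nat \<Rightarrow> (nat list \<Rightarrow> real) \<Rightarrow> nat \<Rightarrow> real set" where
  "near m p k = {x \<in> {0..<1}. \<exists>n\<ge>k. \<forall>w\<in>words g m.
     \<bar>real (tau g a f w x n) / real (n - m) - p w\<bar> < 1 / real (Suc k)}"

text \<open>The removed points are the left endpoints of cylinders, where a cylinder is not a
  neighbourhood.\<close>
lemma freq_acc_subset_near:
  "{x \<in> {0..<1}. freq_acc g a f m x p} - range (\<lambda>w. Inf (cyl a f w)) \<subseteq> interior (near m p k)"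
proof
  fix x assume x: "x \<in> {x \<in> {0..<1}. freq_acc g a f m x p} - range (\<lambda>w. Inf (cyl a f w))"
  then have x01: "x \<in> {0..<1}" by blast
  from x obtain r where r: "strict_mono r"
    "\<And>w. w \<in> words g m \<Longrightarrow> (\<lambda>k. real (tau g a f w x (r k)) / real (r k - m)) \<longlonglongrightarrow> p w"
    unfolding freq_acc_def by blast
  have "eventually (\<lambda>i. \<forall>w\<in>words g m.
      \<bar>real (tau g a f w x (r i)) / real (r i - m) - p w\<bar> < 1 / real (Suc k)) sequentially"
    using finite_words
  proof (rule eventually_ball_finite, intro ballI)
    fix w assume "w \<in> words g m"
    from tendstoD[OF r(2)[OF this], of "1 / real (Suc k)"]
    show "eventually (\<lambda>i. \<bar>real (tau g a f w x (r i)) / real (r i - m) - p w\<bar> < 1 / real (Suc k)) sequentially"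
      by (simp add: dist_real_def)
  qed
  then obtain i0 where i0: "\<And>i w. i0 \<le> i \<Longrightarrow> w \<in> words g m \<Longrightarrow>
      \<bar>real (tau g a f w x (r i)) / real (r i - m) - p w\<bar> < 1 / real (Suc k)"
    unfolding eventually_sequentially by blast
  \<comment> \<open>A strictly increasing \<open>r\<close> satisfies \<open>r i >= i\<close>, so the
    index \<open>max i0 k\<close> gives both the accuracy and \<open>n >= k\<close>.\<close>
  define n where "n = r (max i0 k)"
  have n: "k \<le> n"
    unfolding n_def using seq_suble[OF r(1), of "max i0 k"] by simp
  have near: "\<bar>real (tau g a f w x n) / real (n - m) - p w\<bar> < 1 / real (Suc k)" if "w \<in> words g m" for w
    unfolding n_def using that by (intro i0) auto
  define u where "u = map (code g a f x) [0..<n]"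
  have u: "u \<in> words g n" using code_mem[OF x01] by (auto simp: u_def words_def)
  have xu: "x \<in> cyl a f u"
    using x01 by (subst mem_cyl_iff[OF u]) (auto simp: u_def)
  obtain l r' where lr: "l < r'" "cyl a f u = {l..<r'}"
    using cyl_branch[OF u] by blast
  have "Inf (cyl a f u) = l" using lr by (simp add: cInf_atLeastLessThan)
  then have "x \<noteq> l" using x by blast
  then have "x \<in> {l<..<r'}" using xu lr by auto
  moreover have "{l<..<r'} \<subseteq> near m p k"
  proof
    fix y assume "y \<in> {l<..<r'}"
    then have y: "y \<in> cyl a f u" using lr by auto
    then have "code g a f y i = code g a f x i" if "i < n" for i
      using that mem_cyl_iff[OF u, of y] by (simp add: u_def)
    then have "tau g a f w y n = tau g a f w x n" for w
      by (rule tau_cong)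
    then show "y \<in> near m p k"
      using near n y unfolding near_def by (auto simp: cyl_def)
  qed
  ultimately show "x \<in> interior (near m p k)"
    by (meson interiorI open_greaterThanLessThan)
qed

lemma near_subset_freq_acc:
  assumes x: "\<And>k. x \<in> near m p k"
  shows "freq_acc g a f m x p"
proof -
  define P where "P k n \<longleftrightarrow> (\<forall>w\<in>words g m.
     \<bar>real (tau g a f w x n) / real (n - m) - p w\<bar> < 1 / real (Suc k))" for k n
  \<comment> \<open>Membership for the larger index \<open>max k N\<close> gives a late time without
    losing the accuracy asked for by \<open>k\<close>; this allows strictly increasing times to be
    chosen.\<close>
  have ex: "\<exists>n\<ge>N. P k n" for k N
  proof -
    from x[of "max k N"] obtain n where n: "max k N \<le> n" "P (max k N) n"
      unfolding near_def P_def by blast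
    have "1 / real (Suc (max k N)) \<le> 1 / real (Suc k)" by (intro divide_left_mono) auto
    with n(2) have "P k n" unfolding P_def by (meson less_le_trans)
    with n(1) show ?thesis by auto
  qed
  have "\<exists>r. \<forall>k. P k (r k) \<and> r k < r (Suc k)"
  proof (rule dependent_nat_choice)
    show "\<exists>n. P 0 n" using ex by blast
    show "\<exists>n'. P (Suc k) n' \<and> n < n'" for n k
      using ex[of "Suc n" "Suc k"] by auto
  qed
  then obtain r where r: "\<And>k. P k (r k)" "\<And>k. r k < r (Suc k)" by blast
  have "(\<lambda>k. real (tau g a f w x (r k)) / real (r k - m)) \<longlonglongrightarrow> p w" if w: "w \<in> words g m" for w
  proof (rule LIM_zero_cancel, rule Lim_null_comparison)
    show "(\<lambda>k. inverse (real (Suc k))) \<longlonglongrightarrow> 0" by (rule LIMSEQ_inverse_real_of_nat)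
    show "eventually (\<lambda>k. norm (real (tau g a f w x (r k)) / real (r k - m) - p w)
        \<le> inverse (real (Suc k))) sequentially"
      using r(1) w by (auto simp: P_def inverse_eq_divide intro!: always_eventually less_imp_le)
  qed
  moreover have "strict_mono r" using r(2) by (simp add: strict_mono_Suc_iff)
  ultimately show ?thesis unfolding freq_acc_def by blast
qed

text \<open>Fullness does not refer to the map, so the open sets arising from different maps can be
  intersected.\<close>

lemma full_near:
  assumes s: "0 < s" "s < hausdorff_dim {x \<in> {0..<1}. freq_acc g a f m x p}"
  shows "full s (interior (near m p k))"
proof -
  define E where "E = {x \<in> {0..<1}. freq_acc g a f m x p}"
  have E01: "E \<subseteq> {0..<1}" by (auto simp: E_def)
  have s1: "s < 1" using s(2) hausdorff_dim_le_1[OF E01] by (simp add: E_def)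
  obtain c where c: "0 < c" "content_ge s c E"
    using content_ge_of_dim[of s E] s by (auto simp: E_def)
  have "x \<in> E" if "x \<in> {0..<1}" "(f ^^ n) x \<in> E" for n x
    using that freq_acc_shift unfolding E_def by blast
  then obtain c' where c': "0 < c'"
    "\<And>x y. 0 \<le> x \<Longrightarrow> x < y \<Longrightarrow> y \<le> 1 \<Longrightarrow> content_ge s (c' * (y - x) powr s) (E \<inter> {x..<y})"
    using content_ge_interval[OF s(1) c E01] by blast
  show ?thesis
  proof (rule fullI[OF s(1) s1 c'(1) _ _ c'(2)])
    show "countable (range (\<lambda>w. Inf (cyl a f w)))" by simp
    show "E - range (\<lambda>w. Inf (cyl a f w)) \<subseteq> interior (near m p k)"
      unfolding E_def by (rule freq_acc_subset_near)
  qed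
qed

end

section \<open>Combining all maps\<close>

theorem mainTheorem3:
  fixes f :: "nat \<Rightarrow> real \<Rightarrow> real" and g :: "nat \<Rightarrow> nat" and a :: "nat \<Rightarrow> nat \<Rightarrow> real"
    and m :: "nat \<Rightarrow> nat" and p :: "nat \<Rightarrow> nat list \<Rightarrow> real"
  assumes "\<And>i. good_map (g i) (a i) (f i)"
    and "\<And>i w. w \<in> words (g i) (m i) \<Longrightarrow> p i w \<in> {0..1}"
  shows "hausdorff_dim (\<Inter>i. {x \<in> {0..<1}. freq_acc (g i) (a i) (f i) (m i) x (p i)})
       = (INF i. hausdorff_dim {x \<in> {0..<1}. freq_acc (g i) (a i) (f i) (m i) x (p i)})"
proof -
  define E where "E i = {x \<in> {0..<1}. freq_acc (g i) (a i) (f i) (m i) x (p i)}" for i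
  have E01: "E i \<subseteq> {0..<1}" for i by (auto simp: E_def)
  then have Int01: "(\<Inter>i. E i) \<subseteq> {0..<1}" by blast
  have nonneg: "0 \<le> hausdorff_dim (E i)" for i
    by (rule hausdorff_dim_geI[OF E01])
  then have bdd: "bdd_below (range (\<lambda>i. hausdorff_dim (E i)))"
    by (intro bdd_belowI[of _ 0]) auto
  have "\<forall>i. \<exists>D K. expanding_map (g i) (a i) (f i) D K"
    using good_map_expanding[OF assms(1)] by meson
  then obtain D K where map: "\<And>i. expanding_map (g i) (a i) (f i) (D i) (K i)"
    by metis
  have "hausdorff_dim (\<Inter>i. E i) \<le> (INF i. hausdorff_dim (E i))"
    by (rule cINF_greatest) (auto intro!: hausdorff_dim_mono E01)
  moreover have "(INF i. hausdorff_dim (E i)) \<le> hausdorff_dim (\<Inter>i. E i)"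
  proof (rule hausdorff_dim_geI[OF Int01], rule ccontr)
    fix r :: real
    assume r: "0 \<le> r" "hausdorff_measure r (\<Inter>i. E i) = 0"
      and "\<not> (INF i. hausdorff_dim (E i)) \<le> r"
    \<comment> \<open>The exponent \<open>r\<close> may be 0, whereas the content lemmas ask for a
      positive one below every dimension; hence the intermediate \<open>s\<close>.\<close>
    then obtain s where s: "r < s" "s < (INF i. hausdorff_dim (E i))"
      using dense not_le by metis
    have s0: "0 < s" using r s by simp
    have dim: "s < hausdorff_dim (E i)" for i
      using s(2) cINF_lower[OF bdd, of i] by simp
    have s1: "s < 1" using dim[of 0] hausdorff_dim_le_1[OF E01[of 0]] by simp
    \<comment> \<open>A single sequence runs through all pairs of a map \<open>i\<close> and an
      accuracy \<open>k\<close>.\<close>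
    define W where "W j = (case prod_decode j of (i, k) \<Rightarrow>
      interior (expanding_map.near (g i) (a i) (f i) (m i) (p i) k))" for j
    have W: "full s (W j)" "open (W j)" for j
      using expanding_map.full_near[OF map s0] dim
      by (auto simp: W_def E_def split: prod.split)
    have WE: "(\<Inter>j. W j) \<subseteq> (\<Inter>i. E i)"
    proof (intro subsetI INT_I)
      fix x i assume x: "x \<in> (\<Inter>j. W j)"
      have near: "x \<in> expanding_map.near (g i) (a i) (f i) (m i) (p i) k" for k
      proof -
        have "x \<in> W (prod_encode (i, k))" using x by blast
        then show ?thesis using interior_subset by (auto simp: W_def)
      qed
      then show "x \<in> E i"
        using expanding_map.near_subset_freq_acc[OF map near] near[of 0]
        by (simp add: E_def expanding_map.near_def[OF map])
    qed
    \<comment> \<open>The measure is a supremum over all scales, so its vanishing gives cheap covers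
      at scale \<open>1/2\<close>, as \<open>full_Inter_cover\<close> requires.\<close>
    have "hausdorff_pre r (1/2) (\<Inter>i. E i) \<le> hausdorff_measure r (\<Inter>i. E i)"
      unfolding hausdorff_measure_def by (rule SUP_upper) simp
    also have "\<dots> < ennreal (1/16)" using r(2) by simp
    also have "ennreal (1/16) = 1/16" by (simp add: divide_ennreal[symmetric])
    finally have "hausdorff_pre r (1/2) (\<Inter>i. E i) < 1/16" .
    then obtain U :: "nat \<Rightarrow> real set" where U: "(\<Inter>i. E i) \<subseteq> (\<Union>j. U j)" "\<And>j. bounded (U j)"
      "\<And>j. diameter (U j) \<le> 1/2" "(\<Sum>j. ennreal (diameter (U j) powr r)) < 1/16"
      unfolding hausdorff_pre_def INF_less_iff by blast
    have "1/16 \<le> (\<Sum>j. ennreal (diameter (U j) powr s))"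
      by (rule full_Inter_cover[OF s0 s1 W U(2,3) order_trans[OF WE U(1)]])
    \<comment> \<open>Diameters are below 1, so the larger exponent gives the smaller sum.\<close>
    also have "\<dots> \<le> (\<Sum>j. ennreal (diameter (U j) powr r))"
    proof (intro suminf_le ennreal_leI)
      show "diameter (U j) powr s \<le> diameter (U j) powr r" for j
        using U(3)[of j] diameter_ge_0[OF U(2)[of j]] s(1) by (intro powr_mono') auto
    qed auto
    finally show False using U(4) by simp
  qed
  ultimately show ?thesis unfolding E_def by (rule antisym)
qed

end
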